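(* Let $\kappa$ be a regular cardinal and $\delta$ an ordinal. Then $|\mathcal{P}(\delta)\cap C^*_\kappa|\le(|\delta|\cdot\kappa^+)^+$.
   Context: For a logic $\mathcal{L}^*$, $C(\mathcal{L}^* )=\bigcup_\alpha L'_\alpha$, where $L'_0=\emptyset$, $L'_{\alpha+1}$ is the set of all $\{a\in L'_\alpha:(L'_\alpha,\in)\models\varphi(a,\vec b)\}$ with $\varphi(x,\vec y)$ a formula of $\mathcal{L}^*$ and $\vec b\in L'_\alpha$ (truth evaluated in $V$), and unions at limits. For regular $\kappa$, $\mathcal{M}\models Q^{cf}_\kappa xy\,\varphi(x,y,\vec a)$ iff $\{(c,d):\mathcal{M}\models\varphi(c,d,\vec a)\}$ is a linear order of cofinality $\kappa$ (in $V$), and $C^*_\kappa=C(\mathcal{L}(Q^{cf}_\kappa))$ with $\mathcal{L}(Q^{cf}_\kappa)$ first order logic extended by $Q^{cf}_\kappa$. Cardinalities are computed in $V$. *)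

theory Defs
  imports Main
begin

unbundle cardinal_syntax

text \<open>
  The universe \<open>V\<close> of sets is a type carrying a membership structure that satisfies the
  axioms of ZFC. Separation and replacement range over arbitrary HOL predicates and functions,
  so every HOL subset of (and every HOL function on) the elements of a set is itself a set of
  the universe. Hence the HOL cardinality of \<open>elts x\<close> is the cardinality of \<open>x\<close> computed in
  \<open>V\<close>, and likewise for cofinalities. The axiom of choice is inherited from HOL.
  Proper classes are the elements of \<open>'v set\<close> that are not in the range of \<open>elts\<close>.
\<close>

class zfc_universe =
  fixes elts :: "'a \<Rightarrow> 'a set"
  assumes extensionality: "elts x = elts y \<Longrightarrow> x = y"
    and foundation: "wf {(x, y). x \<in> elts y}"
    and separation: "Y \<subseteq> elts x \<Longrightarrow> \<exists>y. elts y = Y"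
    and pairing: "\<exists>z. elts z = {x, y}"
    and union: "\<exists>y. elts y = (\<Union>z\<in>elts x. elts z)"
    and power_set: "\<exists>y. elts y = {z. elts z \<subseteq> elts x}"
    and replacement: "\<exists>y. elts y = f ` elts x"
    and infinity: "\<exists>x. (\<exists>z\<in>elts x. elts z = {}) \<and>
                       (\<forall>y\<in>elts x. \<exists>z\<in>elts x. elts z = insert y (elts y))"

definition mem_rel :: "'v::zfc_universe rel" where
  "mem_rel = {(x, y). x \<in> elts y}"

definition transitive_set :: "'v::zfc_universe \<Rightarrow> bool" where
  "transitive_set x \<longleftrightarrow> (\<forall>y\<in>elts x. elts y \<subseteq> elts x)"

definition ordinal :: "'v::zfc_universe \<Rightarrow> bool" where
  "ordinal \<alpha> \<longleftrightarrow> transitive_set \<alpha> \<and> (\<forall>\<beta>\<in>elts \<alpha>. transitive_set \<beta>)"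

definition ord_rel :: "'v::zfc_universe \<Rightarrow> 'v rel" where
  "ord_rel \<alpha> = {(\<beta>, \<gamma>). \<beta> \<in> elts \<alpha> \<and> \<gamma> \<in> elts \<alpha> \<and> (\<beta> \<in> elts \<gamma> \<or> \<beta> = \<gamma>)}"

text \<open>\<open>Card_order (ord_rel \<kappa>)\<close> says that the ordinal \<open>\<kappa>\<close> is an initial ordinal.\<close>

definition regular_cardinal :: "'v::zfc_universe \<Rightarrow> bool" where
  "regular_cardinal \<kappa> \<longleftrightarrow>
     ordinal \<kappa> \<and> infinite (elts \<kappa>) \<and> Card_order (ord_rel \<kappa>) \<and> regularCard (ord_rel \<kappa>)"

text \<open>
  The library's \<open>cofinal\<close> demands strict upper bounds, which is not what defines the cofinality
  of an order that has a greatest element.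
\<close>

definition cofinal_subset :: "'a set \<Rightarrow> 'a rel \<Rightarrow> bool" where
  "cofinal_subset A r \<longleftrightarrow> A \<subseteq> Field r \<and> (\<forall>a\<in>Field r. \<exists>b\<in>A. (a, b) \<in> r)"

definition has_cofinality :: "'a rel \<Rightarrow> 'k rel \<Rightarrow> bool" where
  "has_cofinality r k \<longleftrightarrow>
     (\<exists>A. cofinal_subset A r \<and> |A| =o k) \<and> (\<forall>A. cofinal_subset A r \<longrightarrow> k \<le>o |A| )"

text \<open>
  First-order logic in the vocabulary of one binary relation, with equality, extended by the
  quantifier \<open>Qcf x y \<phi>\<close>. Linear orders are reflexive on their field, as usual in the library;
  in the presence of equality strict orders give a logic with the same definable sets.
\<close>

datatype fm =
    Mem nat nat
  | Equ nat nat
  | Neg fm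
  | And fm fm
  | Exi nat fm
  | Qcf nat nat fm

primrec fv :: "fm \<Rightarrow> nat set" where
  "fv (Mem x y) = {x, y}"
| "fv (Equ x y) = {x, y}"
| "fv (Neg \<phi>) = fv \<phi>"
| "fv (And \<phi> \<psi>) = fv \<phi> \<union> fv \<psi>"
| "fv (Exi x \<phi>) = fv \<phi> - {x}"
| "fv (Qcf x y \<phi>) = fv \<phi> - {x, y}"

primrec sat_cf :: "'k rel \<Rightarrow> 'a set \<Rightarrow> 'a rel \<Rightarrow> (nat \<Rightarrow> 'a) \<Rightarrow> fm \<Rightarrow> bool" where
  "sat_cf k M E s (Mem x y) \<longleftrightarrow> (s x, s y) \<in> E"
| "sat_cf k M E s (Equ x y) \<longleftrightarrow> s x = s y"
| "sat_cf k M E s (Neg \<phi>) \<longleftrightarrow> \<not> sat_cf k M E s \<phi>"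
| "sat_cf k M E s (And \<phi> \<psi>) \<longleftrightarrow> sat_cf k M E s \<phi> \<and> sat_cf k M E s \<psi>"
| "sat_cf k M E s (Exi x \<phi>) \<longleftrightarrow> (\<exists>c\<in>M. sat_cf k M E (s(x := c)) \<phi>)"
| "sat_cf k M E s (Qcf x y \<phi>) \<longleftrightarrow>
     (let r = {(c, d). c \<in> M \<and> d \<in> M \<and> sat_cf k M E (s(x := c, y := d)) \<phi>}
      in Linear_order r \<and> has_cofinality r k)"

text \<open>
  A logic is given by the free variables of its formulas and its satisfaction relation.
  Only the values of \<open>s\<close> at the parameter variables have to lie in \<open>M\<close>; in particular formulas
  without parameters may be used over the empty structure, so the first level is \<open>{\<emptyset>}\<close>.
\<close>

definition definable_subsets ::
  "('f \<Rightarrow> nat set) \<Rightarrow> ('v set \<Rightarrow> 'v rel \<Rightarrow> (nat \<Rightarrow> 'v) \<Rightarrow> 'f \<Rightarrow> bool) \<Rightarrow>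
     'v::zfc_universe set \<Rightarrow> 'v set" where
  "definable_subsets free sat M =
     {y. \<exists>\<phi> x s. (\<forall>v\<in>free \<phi> - {x}. s v \<in> M) \<and>
                  elts y = {a \<in> M. sat M (mem_rel \<inter> M \<times> M) (s(x := a)) \<phi>}}"

definition is_succ :: "'v::zfc_universe \<Rightarrow> 'v \<Rightarrow> bool" where
  "is_succ \<beta> \<alpha> \<longleftrightarrow> elts \<alpha> = insert \<beta> (elts \<beta>)"

definition L_level ::
  "('f \<Rightarrow> nat set) \<Rightarrow> ('v set \<Rightarrow> 'v rel \<Rightarrow> (nat \<Rightarrow> 'v) \<Rightarrow> 'f \<Rightarrow> bool) \<Rightarrow>
     'v::zfc_universe \<Rightarrow> 'v set" where
  "L_level free sat = wfrec mem_rel (\<lambda>L \<alpha>.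
     if elts \<alpha> = {} then {}
     else if \<exists>\<beta>. is_succ \<beta> \<alpha> then definable_subsets free sat (L (THE \<beta>. is_succ \<beta> \<alpha>))
     else (\<Union>\<beta>\<in>elts \<alpha>. L \<beta>))"

definition C_logic ::
  "('f \<Rightarrow> nat set) \<Rightarrow> ('v set \<Rightarrow> 'v rel \<Rightarrow> (nat \<Rightarrow> 'v) \<Rightarrow> 'f \<Rightarrow> bool) \<Rightarrow>
     'v::zfc_universe set" where
  "C_logic free sat = (\<Union>\<alpha>\<in>{\<alpha>. ordinal \<alpha>}. L_level free sat \<alpha>)"

definition C_star :: "'v::zfc_universe \<Rightarrow> 'v set" where
  "C_star \<kappa> = C_logic fv (sat_cf |elts \<kappa>| )"


lemma wf_mem_rel: "wf (mem_rel :: 'v::zfc_universe rel)"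
  using foundation by (simp add: mem_rel_def)

lemma is_succ_unique:
  assumes "is_succ \<beta> \<alpha>" "is_succ \<gamma> \<alpha>"
  shows "\<beta> = \<gamma>"
proof (rule ccontr)
  assume "\<beta> \<noteq> \<gamma>"
  moreover have "insert \<beta> (elts \<beta>) = insert \<gamma> (elts \<gamma>)"
    using assms by (simp add: is_succ_def)
  ultimately have "\<beta> \<in> elts \<gamma>" "\<gamma> \<in> elts \<beta>"
    by (metis insertE insertI1)+
  then show False
    using wf_not_sym[OF wf_mem_rel, of \<beta> \<gamma>] by (simp add: mem_rel_def)
qed

lemma L_level_unfold:
  "L_level free sat \<alpha> =
     (if elts \<alpha> = {} then {}
      else if \<exists>\<beta>. is_succ \<beta> \<alpha>
        then definable_subsets free sat (L_level free sat (THE \<beta>. is_succ \<beta> \<alpha>))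
      else (\<Union>\<beta>\<in>elts \<alpha>. L_level free sat \<beta>))"
proof -
  have "(THE \<beta>. is_succ \<beta> \<alpha>) \<in> elts \<alpha>" if "is_succ \<beta> \<alpha>" for \<beta>
  proof -
    have "(THE \<beta>. is_succ \<beta> \<alpha>) = \<beta>"
      using that is_succ_unique by blast
    then show ?thesis
      using that by (simp add: is_succ_def)
  qed
  then show ?thesis
    unfolding L_level_def by (subst wfrec[OF wf_mem_rel]) (auto simp: cut_apply mem_rel_def)
qed

lemma L_level_zero: "elts \<alpha> = {} \<Longrightarrow> L_level free sat \<alpha> = {}"
  by (simp add: L_level_unfold)

lemma L_level_succ:
  assumes "is_succ \<beta> \<alpha>"
  shows "L_level free sat \<alpha> = definable_subsets free sat (L_level free sat \<beta>)"
proof -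
  have "(THE \<beta>. is_succ \<beta> \<alpha>) = \<beta>"
    using assms is_succ_unique by blast
  moreover have "elts \<alpha> \<noteq> {}"
    using assms by (auto simp: is_succ_def)
  ultimately show ?thesis
    using assms by (subst L_level_unfold) auto
qed

lemma L_level_limit:
  assumes "elts \<alpha> \<noteq> {}" "\<nexists>\<beta>. is_succ \<beta> \<alpha>"
  shows "L_level free sat \<alpha> = (\<Union>\<beta>\<in>elts \<alpha>. L_level free sat \<beta>)"
  using assms by (subst L_level_unfold) auto

end

theory Submission
  imports Defs "HOL-Library.Countable_Set"
begin

text \<open>
  Put \<open>\<lambda> = |\<delta>| \<cdot> \<kappa>\<^sup>+\<close> and let \<open>a \<subseteq> \<delta>\<close> belong to the level \<open>L'\<^sub>\<alpha>\<close>. Build a Skolem hull \<open>N\<close> of size at most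
  \<open>\<lambda>\<close> with \<open>\<delta> \<union> {a, \<alpha>} \<subseteq> N\<close> as the union of a chain of length \<open>\<kappa>\<^sup>+\<close>. A definable linear order
  of cofinality at most \<open>\<lambda>\<close> keeps its cofinality when restricted to \<open>N\<close>, because a cofinal subset
  is put into \<open>N\<close>; one of larger cofinality gets cofinality \<open>\<kappa>\<^sup>+ \<noteq> \<kappa>\<close>, because each stage of the
  chain is bounded at the next one. Hence \<open>N \<inter> L'\<^sub>\<beta>\<close> is elementary in \<open>L'\<^sub>\<beta>\<close> for the logic with the
  cofinality quantifier for all \<open>\<beta> \<in> N\<close>, and the transitive collapse of \<open>N\<close> maps levels onto
  levels. It fixes \<open>a\<close>, so \<open>a\<close> lies in a level indexed by an ordinal of size at most \<open>\<lambda>\<close>. There are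
  at most \<open>\<lambda>\<^sup>+\<close> such ordinals, and each of these levels has size at most \<open>\<lambda>\<close>.
\<close>

section \<open>Closure arguments and cofinalities\<close>

lemma countable_ordLeq_Cinfinite:
  assumes "Cinfinite l" "countable A"
  shows "|A| \<le>o l"
proof -
  have "|A| \<le>o |UNIV :: nat set|"
    using assms(2) unfolding countable_def card_of_ordLeq[symmetric] by auto
  then show ?thesis
    using natLeq_ordLeq_cinfinite[OF assms(1)] card_of_nat
    by (meson ordIso_ordLeq_trans ordLeq_transitive)
qed

lemma ordLeq_subset:
  assumes "A \<subseteq> B" "|B| \<le>o l"
  shows "|A| \<le>o l"
  using assms card_of_mono1 ordLeq_transitive by blast

lemma Cinfinite_Un:
  assumes "Cinfinite l" "|A| \<le>o l" "|B| \<le>o l"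
  shows "|A \<union> B| \<le>o l"
  using assms by (intro card_of_Un_ordLeq_infinite_Field) (auto simp: cinfinite_def)

lemma Cinfinite_UNION:
  assumes "Cinfinite l" "|I| \<le>o l" "\<And>i. i \<in> I \<Longrightarrow> |A i| \<le>o l"
  shows "|\<Union>i\<in>I. A i| \<le>o l"
  using assms by (intro card_of_UNION_ordLeq_infinite_Field) (auto simp: cinfinite_def)

text \<open>Finite sequences serve as parameter tuples, both in closure arguments and in counting
  definable sets. Splitting off the head bounds the sequences of each fixed length, and there are
  only countably many lengths.\<close>

lemma card_of_lists_ordLeq:
  assumes l: "Cinfinite l" and A: "|A| \<le>o l"
  shows "|lists A| \<le>o l"
proof -
  have inf: "\<not> finite (Field l)" "Card_order l"
    using l by (auto simp: cinfinite_def)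
  have len: "|{xs \<in> lists A. length xs = n}| \<le>o l" for n
  proof (induction n)
    case 0
    have "{xs \<in> lists A. length xs = 0} = {[]}"
      by auto
    then show ?case
      using l by (intro countable_ordLeq_Cinfinite) auto
  next
    case (Suc n)
    let ?X = "A \<times> {xs \<in> lists A. length xs = n}"
    have "inj_on (\<lambda>xs. (hd xs, tl xs)) {xs \<in> lists A. length xs = Suc n}"
      by (rule inj_onI) (auto intro: list.expand)
    then have "|{xs \<in> lists A. length xs = Suc n}| \<le>o |?X|"
    proof (rule card_of_ordLeqI)
      fix xs assume "xs \<in> {xs \<in> lists A. length xs = Suc n}"
      then show "(hd xs, tl xs) \<in> ?X"
        by (cases xs) auto
    qed
    moreover have "|?X| \<le>o l"
      by (rule card_of_Times_ordLeq_infinite_Field[OF inf(1) A Suc inf(2)])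
    ultimately show ?case
      by (rule ordLeq_transitive)
  qed
  have "|UNIV :: nat set| \<le>o l"
    using natLeq_ordLeq_cinfinite[OF l] card_of_nat ordIso_ordLeq_trans by blast
  then have "|\<Union>n. {xs \<in> lists A. length xs = n}| \<le>o l"
    by (rule Cinfinite_UNION[OF l _ len])
  moreover have "(\<Union>n. {xs \<in> lists A. length xs = n}) = lists A"
    by auto
  ultimately show ?thesis
    by simp
qed

text \<open>
  \<open>N\<close> is the union of an increasing chain of length \<open>cardSuc k\<close>: by regularity of \<open>cardSuc k\<close>
  every subset of size at most \<open>k\<close> already lies in a member of the chain.
\<close>

lemma successor_length_closure:
  fixes k :: "'k rel" and l :: "'l rel" and G :: "'a set \<Rightarrow> 'a set"
  assumes k: "Cinfinite k" and l: "Card_order l" and kl: "cardSuc k \<le>o l"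
    and G: "\<And>S. |S| \<le>o l \<Longrightarrow> |G S| \<le>o l"
    and B: "|B| \<le>o l"
  shows "\<exists>N. B \<subseteq> N \<and> |N| \<le>o l \<and>
           (\<forall>C\<subseteq>N. |C| \<le>o k \<longrightarrow> (\<exists>S. C \<subseteq> S \<and> |S| \<le>o l \<and> G S \<subseteq> N))"
proof -
  define K where "K = cardSuc k"
  have K: "Cinfinite K"
    unfolding K_def using k by (rule Cinfinite_cardSuc)
  have lI: "Cinfinite l"
    using K kl l cinfinite_mono unfolding K_def by blast
  have wo: "Well_order K"
    using K card_order_on_well_order_on by blast
  then have wf: "wf (K - Id)" and trans: "trans K" and antisym: "antisym K"
    by (auto simp: order_on_defs)
  define h where "h = wfrec (K - Id) (\<lambda>f i. G (B \<union> (\<Union>j\<in>underS K i. f j)))"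
  define As where "As i = B \<union> (\<Union>j\<in>underS K i. h j)" for i
  have h: "h i = G (As i)" for i
  proof -
    have "h i = G (B \<union> (\<Union>j\<in>underS K i. cut h (K - Id) i j))"
      unfolding h_def by (subst wfrec[OF wf]) simp
    also have "(\<Union>j\<in>underS K i. cut h (K - Id) i j) = (\<Union>j\<in>underS K i. h j)"
      by (intro SUP_cong refl) (auto simp: cut_apply underS_def)
    finally show ?thesis
      by (simp add: As_def)
  qed
  have card: "i \<in> Field K \<Longrightarrow> |As i| \<le>o l" for i
    using wf
  proof (induction i rule: wf_induct_rule)
    case (less i)
    have "|underS K i| \<le>o l"
      using card_of_underS[of K i] less.prems K kl
      unfolding K_def by (meson ordLess_imp_ordLeq ordLeq_transitive)
    moreover have "|h j| \<le>o l" if "j \<in> underS K i" for j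
      unfolding h using less.IH[of j] that by (intro G) (auto simp: underS_def Field_def)
    ultimately show ?case
      unfolding As_def by (intro Cinfinite_Un Cinfinite_UNION lI B)
  qed
  have mono: "relChain K As"
  proof -
    have "underS K i \<subseteq> underS K j" if "(i, j) \<in> K" for i j
      using that trans antisym unfolding underS_def by (auto dest: transD antisymD)
    then show ?thesis
      unfolding relChain_def As_def by blast
  qed
  define N where "N = (\<Union>i\<in>Field K. As i)"
  have "Field K \<noteq> {}"
    using K by (auto simp: cinfinite_def)
  then have "B \<subseteq> N"
    by (auto simp: N_def As_def)
  moreover have "|Field K| \<le>o l"
    using card_of_Field_ordIso[of K] K kl unfolding K_def by (meson ordIso_ordLeq_trans)
  then have "|N| \<le>o l"
    unfolding N_def by (intro Cinfinite_UNION lI card)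
  moreover have "\<exists>S. C \<subseteq> S \<and> |S| \<le>o l \<and> G S \<subseteq> N" if C: "C \<subseteq> N" "|C| \<le>o k" for C
  proof -
    obtain i where i: "i \<in> Field K" "C \<subseteq> As i"
      using cardSuc_UNION_Cinfinite[OF k mono[unfolded K_def] _ C(2)] C(1)
      unfolding N_def K_def by blast
    \<comment> \<open>\<open>G (As i)\<close> enters the chain only after stage \<open>i\<close>, so
      a later index is needed; an infinite cardinal order has no last element.\<close>
    obtain j where "j \<in> Field K" "i \<noteq> j" "(i, j) \<in> K"
      using infinite_Card_order_limit[of K i] K i(1) by (auto simp: cinfinite_def)
    then have "G (As i) \<subseteq> As j"
      by (auto simp: As_def[of j] underS_def h)
    then show ?thesis
      using i card \<open>j \<in> Field K\<close> by (auto simp: N_def)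
  qed
  ultimately show ?thesis
    by blast
qed

text \<open>A condition \<open>R xs S T\<close> is to be read as: \<open>T\<close> answers the
  demand made by the parameters \<open>xs\<close> at the stage \<open>S\<close>. Each demand is met
  by all supersets of some small set, so it suffices to close off under chosen small sets. That
  \<open>S\<close> can be taken to absorb any given small \<open>C\<close> later yields bounds for
  small sets.\<close>

lemma closure_under_conditions:
  fixes k :: "'k rel" and l :: "'l rel"
    and I :: "('a list \<Rightarrow> 'a set \<Rightarrow> 'a set \<Rightarrow> bool) set"
  assumes k: "Cinfinite k" and l: "Card_order l" and kl: "cardSuc k \<le>o l"
    and I: "|I| \<le>o l"
    and W: "\<And>R xs S. R \<in> I \<Longrightarrow> set xs \<subseteq> S \<Longrightarrow> |S| \<le>o l \<Longrightarrow>
              \<exists>W. |W| \<le>o l \<and> (\<forall>T. W \<subseteq> T \<longrightarrow> R xs S T)"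
    and B: "|B| \<le>o l"
  shows "\<exists>N. B \<subseteq> N \<and> |N| \<le>o l \<and>
           (\<forall>R\<in>I. \<forall>xs C. set xs \<subseteq> N \<longrightarrow> C \<subseteq> N \<longrightarrow> |C| \<le>o k \<longrightarrow> (\<exists>S. C \<subseteq> S \<and> R xs S N))"
proof -
  have lI: "Cinfinite l"
    using Cinfinite_cardSuc[OF k] kl l cinfinite_mono by blast
  define V where "V R xs S = (SOME W. |W| \<le>o l \<and> (\<forall>T. W \<subseteq> T \<longrightarrow> R xs S T))"
    for R :: "'a list \<Rightarrow> 'a set \<Rightarrow> 'a set \<Rightarrow> bool" and xs S
  have V: "|V R xs S| \<le>o l \<and> (\<forall>T. V R xs S \<subseteq> T \<longrightarrow> R xs S T)"
    if "R \<in> I" "set xs \<subseteq> S" "|S| \<le>o l" for R xs S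
    unfolding V_def using W[OF that] by (rule someI_ex)
  define G where "G S = (\<Union>R\<in>I. \<Union>xs\<in>lists S. V R xs S)" for S
  have "|G S| \<le>o l" if "|S| \<le>o l" for S
    unfolding G_def using that V
    by (intro Cinfinite_UNION lI I card_of_lists_ordLeq) (auto simp: in_lists_conv_set subset_iff)
  from successor_length_closure[OF k l kl this B] obtain N where
    N: "B \<subseteq> N \<and> |N| \<le>o l \<and>
      (\<forall>C\<subseteq>N. |C| \<le>o k \<longrightarrow> (\<exists>S. C \<subseteq> S \<and> |S| \<le>o l \<and> G S \<subseteq> N))" ..
  have *: "\<exists>S. C \<subseteq> S \<and> R xs S N"
    if R: "R \<in> I" and xs: "set xs \<subseteq> N" and C: "C \<subseteq> N" "|C| \<le>o k" for R xs C
  proof -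
    \<comment> \<open>The parameters join \<open>C\<close>, so that one stage contains both and
      \<open>xs\<close> is among the sequences handled by \<open>G S\<close>.\<close>
    have "|C \<union> set xs| \<le>o k"
      by (intro Cinfinite_Un k C(2) countable_ordLeq_Cinfinite countable_finite finite_set)
    then obtain S where S: "C \<union> set xs \<subseteq> S" "|S| \<le>o l" "G S \<subseteq> N"
      using N xs C(1) by (metis Un_subset_iff)
    then have "xs \<in> lists S"
      by auto
    then have "V R xs S \<subseteq> N"
      using S(3) R unfolding G_def by blast
    then show ?thesis
      using V[OF R _ S(2), of xs] S(1) by blast
  qed
  show ?thesis
    using N by (intro exI[of _ N] conjI ballI allI impI *) simp_all
qed

section \<open>Linear orders and cofinalities\<close>

text \<open>Each axiom of linear orders fails at finitely many points, and the failure persists in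
  any restriction that keeps them. Reflexivity and totality speak of the field, so there a related
  partner of each point is kept as well.\<close>

lemma not_Linear_order_finite_witness:
  assumes "\<not> Linear_order r"
  shows "\<exists>F. finite F \<and> (\<forall>T. F \<subseteq> T \<longrightarrow> \<not> Linear_order (r \<inter> T \<times> T))"
proof -
  have defs: "Linear_order q \<longleftrightarrow>
      (\<forall>a\<in>Field q. (a, a) \<in> q) \<and> (\<forall>a b c. (a, b) \<in> q \<longrightarrow> (b, c) \<in> q \<longrightarrow> (a, c) \<in> q) \<and>
      (\<forall>a b. (a, b) \<in> q \<longrightarrow> (b, a) \<in> q \<longrightarrow> a = b) \<and>
      (\<forall>a\<in>Field q. \<forall>b\<in>Field q. a \<noteq> b \<longrightarrow> (a, b) \<in> q \<or> (b, a) \<in> q)" for q :: "'a rel"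
  proof -
    have "q \<subseteq> Field q \<times> Field q"
      by (auto intro: FieldI1 FieldI2)
    then show ?thesis
      unfolding order_on_defs refl_on_def trans_def antisym_def total_on_def by blast
  qed
  have partner: "\<exists>b. (a, b) \<in> r \<or> (b, a) \<in> r" if "a \<in> Field r" for a
    using that by (auto simp: Field_def)
  consider (tr) a b c where "(a, b) \<in> r" "(b, c) \<in> r" "(a, c) \<notin> r"
    | (anti) a b where "(a, b) \<in> r" "(b, a) \<in> r" "a \<noteq> b"
    | (tot) a b where "a \<in> Field r" "b \<in> Field r" "a \<noteq> b" "(a, b) \<notin> r" "(b, a) \<notin> r"
    | (refl) a where "a \<in> Field r" "(a, a) \<notin> r"
    using assms unfolding defs by blast
  then show ?thesis
  proof cases
    case tr
    then show ?thesis
      by (intro exI[of _ "{a, b, c}"]) (unfold defs, blast)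
  next
    case anti
    then show ?thesis
      by (intro exI[of _ "{a, b}"]) (unfold defs, blast)
  next
    case tot
    obtain a' b' where ab: "(a, a') \<in> r \<or> (a', a) \<in> r" "(b, b') \<in> r \<or> (b', b) \<in> r"
      using tot partner by blast
    have "\<not> Linear_order (r \<inter> T \<times> T)" if "{a, a', b, b'} \<subseteq> T" for T
    proof -
      have "a \<in> Field (r \<inter> T \<times> T)" "b \<in> Field (r \<inter> T \<times> T)"
        using ab that by (auto simp: Field_def)
      then show ?thesis
        using tot unfolding defs by blast
    qed
    then show ?thesis
      by (intro exI[of _ "{a, a', b, b'}"]) simp
  next
    case refl
    obtain b where ab: "(a, b) \<in> r \<or> (b, a) \<in> r"
      using refl partner by blast
    have "\<not> Linear_order (r \<inter> T \<times> T)" if "{a, b} \<subseteq> T" for T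
    proof -
      have "a \<in> Field (r \<inter> T \<times> T)"
        using ab that by (auto simp: Field_def)
      then show ?thesis
        using refl unfolding defs by blast
    qed
    then show ?thesis
      by (intro exI[of _ "{a, b}"]) simp
  qed
qed

lemma Field_restrict:
  assumes "Refl r"
  shows "Field (r \<inter> T \<times> T) = Field r \<inter> T"
  using assms by (auto simp: Field_def refl_on_def)

text \<open>Each element of \<open>B\<close> is sent to an element of \<open>A\<close> above it; the
  image is still cofinal.\<close>

lemma cofinal_subset_shrink:
  assumes "trans r" "cofinal_subset A r" "cofinal_subset B r"
  shows "\<exists>B'\<subseteq>A. cofinal_subset B' r \<and> |B'| \<le>o |B|"
proof -
  obtain f where f: "\<And>b. b \<in> Field r \<Longrightarrow> f b \<in> A \<and> (b, f b) \<in> r"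
    using assms(2) unfolding cofinal_subset_def by metis
  have "cofinal_subset (f ` B) r"
    unfolding cofinal_subset_def
  proof (intro conjI ballI)
    show "f ` B \<subseteq> Field r"
      using f assms(2,3) unfolding cofinal_subset_def by blast
  next
    fix a assume "a \<in> Field r"
    then obtain b where b: "b \<in> B" "b \<in> Field r" "(a, b) \<in> r"
      using assms(3) unfolding cofinal_subset_def by blast
    then show "\<exists>b\<in>f ` B. (a, b) \<in> r"
      using f[of b] transD[OF assms(1)] by blast
  qed
  moreover have "f ` B \<subseteq> A"
    using f assms(3) unfolding cofinal_subset_def by blast
  ultimately show ?thesis
    using card_of_image by blast
qed

text \<open>Through \<open>A\<close> every cofinal set of the restriction is cofinal in
  \<open>r\<close>; conversely a cofinal set of \<open>r\<close> can be moved into \<open>A\<close>,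
  hence into \<open>T\<close>, without growing.\<close>

lemma has_cofinality_restrict:
  assumes r: "Refl r" "trans r" and A: "cofinal_subset A r" "A \<subseteq> T"
  shows "has_cofinality (r \<inter> T \<times> T) k \<longleftrightarrow> has_cofinality r k"
proof -
  have F: "Field (r \<inter> T \<times> T) = Field r \<inter> T"
    using r(1) by (rule Field_restrict)
  have up: "cofinal_subset C r" if C: "cofinal_subset C (r \<inter> T \<times> T)" for C
    unfolding cofinal_subset_def
  proof (intro conjI ballI)
    show "C \<subseteq> Field r"
      using C F unfolding cofinal_subset_def by blast
  next
    fix a assume "a \<in> Field r"
    then obtain b where b: "b \<in> A" "(a, b) \<in> r" "b \<in> Field r"
      using A(1) unfolding cofinal_subset_def by blast
    then obtain c where "c \<in> C" "(b, c) \<in> r"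
      using C F A(2) unfolding cofinal_subset_def by blast
    then show "\<exists>b\<in>C. (a, b) \<in> r"
      using b(2) r(2) by (meson transD)
  qed
  have down: "cofinal_subset C (r \<inter> T \<times> T)" if "cofinal_subset C r" "C \<subseteq> T" for C
    using that F unfolding cofinal_subset_def by blast
  note shrink = cofinal_subset_shrink[OF r(2) A(1)]
  show ?thesis
  proof
    assume *: "has_cofinality (r \<inter> T \<times> T) k"
    then obtain C where "cofinal_subset C (r \<inter> T \<times> T)" "|C| =o k"
      unfolding has_cofinality_def by blast
    moreover have "k \<le>o |B|" if "cofinal_subset B r" for B
    proof -
      obtain B' where B': "B' \<subseteq> A" "cofinal_subset B' r" "|B'| \<le>o |B|"
        using shrink \<open>cofinal_subset B r\<close> by blast
      then have "k \<le>o |B'|"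
        using * down A(2) unfolding has_cofinality_def by blast
      then show ?thesis
        using B'(3) ordLeq_transitive by blast
    qed
    ultimately show "has_cofinality r k"
      using up unfolding has_cofinality_def by blast
  next
    assume *: "has_cofinality r k"
    then obtain B where B: "cofinal_subset B r" "|B| =o k"
      unfolding has_cofinality_def by blast
    then obtain B' where B': "B' \<subseteq> A" "cofinal_subset B' r" "|B'| \<le>o |B|"
      using shrink by blast
    then have "|B'| =o k"
      using * B(2) unfolding has_cofinality_def ordIso_iff_ordLeq
      by (meson ordLeq_transitive)
    moreover have "cofinal_subset B' (r \<inter> T \<times> T)"
      using B' A(2) down by blast
    ultimately show "has_cofinality (r \<inter> T \<times> T) k"
      using * up unfolding has_cofinality_def by blast
  qed
qed

lemma has_cofinality_dir_image:
  assumes inj: "inj_on f (Field r)" and r: "has_cofinality r k"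
  shows "has_cofinality (dir_image r f) k"
proof -
  have card: "|f ` A| =o |A|" if "A \<subseteq> Field r" for A
    using that inj by (meson card_of_ordIso inj_on_imp_bij_betw inj_on_subset ordIso_symmetric)
  obtain A where A: "cofinal_subset A r" "|A| =o k"
    using r unfolding has_cofinality_def by blast
  then have "cofinal_subset (f ` A) (dir_image r f)"
    unfolding cofinal_subset_def dir_image_Field by (auto simp: dir_image_def) blast
  moreover have "|f ` A| =o k"
    using A card unfolding cofinal_subset_def by (meson ordIso_transitive)
  moreover have "k \<le>o |B|" if B: "cofinal_subset B (dir_image r f)" for B
  proof -
    define C where "C = {a \<in> Field r. f a \<in> B}"
    have "cofinal_subset C r"
      unfolding cofinal_subset_def
    proof (intro conjI ballI)
      fix a assume "a \<in> Field r"
      then obtain b where b: "b \<in> B" "(f a, b) \<in> dir_image r f"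
        using B unfolding cofinal_subset_def dir_image_Field by blast
      then obtain a' c where "(a', c) \<in> r" "f a' = f a" "b = f c"
        unfolding dir_image_def by auto
      moreover from this have "a' = a"
        using inj \<open>a \<in> Field r\<close> by (meson FieldI1 inj_onD)
      ultimately show "\<exists>c\<in>C. (a, c) \<in> r"
        using b(1) unfolding C_def by (auto intro: FieldI2)
    qed (auto simp: C_def)
    then have "k \<le>o |C|"
      using r unfolding has_cofinality_def by blast
    moreover have "|C| \<le>o |B|"
      using inj by (intro card_of_ordLeqI[of f]) (auto simp: C_def inj_on_def)
    ultimately show ?thesis
      by (rule ordLeq_transitive)
  qed
  ultimately show ?thesis
    unfolding has_cofinality_def by blast
qed

lemma dir_image_inverse:
  assumes "\<And>a. a \<in> Field r \<Longrightarrow> g (f a) = a"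
  shows "dir_image (dir_image r f) g = r"
proof -
  have "g (f a) = a" "g (f b) = b" if "(a, b) \<in> r" for a b
    using assms that by (auto intro: FieldI1 FieldI2)
  then show ?thesis
    unfolding dir_image_def by force
qed

text \<open>One direction is preservation under \<open>f\<close>, the other is preservation under
  its inverse, which carries the image order back to \<open>r\<close>.\<close>

lemma cofinality_order_dir_image_iff:
  assumes inj: "inj_on f (Field r)"
  shows "Linear_order (dir_image r f) \<and> has_cofinality (dir_image r f) k \<longleftrightarrow>
         Linear_order r \<and> has_cofinality r k"
proof -
  let ?g = "inv_into (Field r) f"
  have "dir_image (dir_image r f) ?g = r"
    using inj by (intro dir_image_inverse) simp
  moreover have "inj_on ?g (Field (dir_image r f))"
    unfolding dir_image_Field by (rule inj_on_inv_into) simp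
  ultimately show ?thesis
    using inj has_cofinality_dir_image Linear_order_dir_image by metis
qed

section \<open>Ordinals and levels\<close>

lemma mem_induct [case_names mem]:
  fixes x :: "'v::zfc_universe"
  assumes "\<And>x. (\<And>y. y \<in> elts x \<Longrightarrow> P y) \<Longrightarrow> P x"
  shows "P x"
  using wf_mem_rel by (induction x rule: wf_induct_rule) (auto intro: assms simp: mem_rel_def)

lemma mem_asym: "x \<in> elts y \<Longrightarrow> y \<notin> elts (x :: 'v::zfc_universe)"
  using wf_not_sym[OF wf_mem_rel] by (auto simp: mem_rel_def)

lemma ordinal_mem: "ordinal \<alpha> \<Longrightarrow> \<beta> \<in> elts \<alpha> \<Longrightarrow> ordinal \<beta>"
  unfolding ordinal_def transitive_set_def by blast

lemma ordinal_trans: "ordinal \<alpha> \<Longrightarrow> \<beta> \<in> elts \<alpha> \<Longrightarrow> \<gamma> \<in> elts \<beta> \<Longrightarrow> \<gamma> \<in> elts \<alpha>"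
  unfolding ordinal_def transitive_set_def by blast

text \<open>Double membership induction: the outer one compares members of \<alpha> with all
  ordinals, the inner one compares \<alpha> with members of \<beta>. If \<alpha> and \<beta> were
  incomparable, each would be included in the other.\<close>

lemma ordinal_linear:
  "ordinal \<alpha> \<Longrightarrow> ordinal \<beta> \<Longrightarrow> \<alpha> \<in> elts \<beta> \<or> \<alpha> = \<beta> \<or> \<beta> \<in> elts \<alpha>"
proof (induction \<alpha> arbitrary: \<beta> rule: mem_induct)
  case (mem \<alpha>)
  note IH = mem.IH and \<alpha> = mem.prems(1)
  show ?case
    using mem.prems(2)
  proof (induction \<beta> rule: mem_induct)
    case (mem \<beta>)
    show ?case
    proof (rule ccontr)
      assume contr: "\<not> ?case"
      have "elts \<alpha> \<subseteq> elts \<beta>"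
      proof
        fix \<gamma> assume "\<gamma> \<in> elts \<alpha>"
        moreover from this have "\<gamma> \<in> elts \<beta> \<or> \<gamma> = \<beta> \<or> \<beta> \<in> elts \<gamma>"
          using IH \<alpha> mem.prems ordinal_mem by blast
        ultimately show "\<gamma> \<in> elts \<beta>"
          using contr \<alpha> ordinal_trans by blast
      qed
      moreover have "elts \<beta> \<subseteq> elts \<alpha>"
      proof
        fix \<gamma> assume "\<gamma> \<in> elts \<beta>"
        moreover from this have "\<alpha> \<in> elts \<gamma> \<or> \<alpha> = \<gamma> \<or> \<gamma> \<in> elts \<alpha>"
          using mem.IH mem.prems ordinal_mem by blast
        ultimately show "\<gamma> \<in> elts \<alpha>"
          using contr mem.prems ordinal_trans by blast
      qed
      ultimately show False
        using contr extensionality by blast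
    qed
  qed
qed

text \<open>Membership well-orders these ordinals. Were there more than \<open>cardSuc l\<close>,
  some \<beta> among them would have predecessors of order type \<open>cardSuc l\<close>; but those
  are members of \<beta>, which has size at most \<open>l\<close>.\<close>

lemma card_ordinals_ordLeq:
  assumes l: "Card_order l"
  shows "|{\<beta> :: 'v::zfc_universe. ordinal \<beta> \<and> |elts \<beta>| \<le>o l}| \<le>o cardSuc l"
proof -
  let ?O = "{\<beta> :: 'v. ordinal \<beta> \<and> |elts \<beta>| \<le>o l}"
  let ?r = "{(\<beta>, \<gamma>). \<beta> \<in> ?O \<and> \<gamma> \<in> ?O \<and> (\<beta> \<in> elts \<gamma> \<or> \<beta> = \<gamma>)}"
  have F: "Field ?r = ?O"
    by (auto simp: Field_def)
  have "refl_on ?O ?r" "?r \<subseteq> ?O \<times> ?O"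
    by (auto simp: refl_on_def)
  moreover have "trans ?r"
    by (rule transI) (use ordinal_trans in blast)
  moreover have "antisym ?r"
    by (rule antisymI) (use mem_asym in blast)
  moreover have "total_on ?O ?r"
    unfolding total_on_def using ordinal_linear by blast
  moreover have "wf (?r - Id)"
    by (rule wf_subset[OF wf_mem_rel]) (auto simp: mem_rel_def)
  ultimately have wo: "Well_order ?r"
    unfolding order_on_defs F by blast
  have cs: "Well_order (cardSuc l)"
    using l by (rule cardSuc_Well_order)
  show ?thesis
  proof (rule ccontr)
    assume "\<not> ?thesis"
    then have "cardSuc l <o |?O|"
      using cs by (simp add: not_ordLeq_iff_ordLess card_of_Well_order)
    also have "|?O| \<le>o ?r"
      using card_of_least[of ?O ?r] wo F by simp
    finally have "cardSuc l <o ?r" .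
    then obtain \<beta> where \<beta>: "\<beta> \<in> ?O" and iso: "cardSuc l =o Restr ?r (underS ?r \<beta>)"
      using ordLess_iff_ordIso_Restr[OF wo cs] unfolding F by blast
    have "|underS ?r \<beta>| \<le>o |elts \<beta>|"
      by (rule card_of_mono1) (auto simp: underS_def)
    also have "|elts \<beta>| \<le>o l"
      using \<beta> by simp
    finally have *: "|underS ?r \<beta>| \<le>o l" .
    have "cardSuc l =o |Field (cardSuc l)|"
      using l card_of_Field_ordIso cardSuc_Card_order ordIso_symmetric by blast
    also have "|Field (cardSuc l)| =o |Field (Restr ?r (underS ?r \<beta>))|"
      using iso by (rule card_of_cong)
    finally have "cardSuc l =o |Field (Restr ?r (underS ?r \<beta>))|" .
    moreover have "|Field (Restr ?r (underS ?r \<beta>))| \<le>o |underS ?r \<beta>|"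
      by (rule card_of_mono1) (auto simp: Field_def)
    ultimately have "cardSuc l \<le>o l"
      using * by (meson ordIso_ordLeq_trans ordLeq_transitive)
    then show False
      using cardSuc_greater[OF l] not_ordLess_ordLeq by blast
  qed
qed

section \<open>Levels, satisfaction and sizes of levels\<close>

lemma L_level_cases [case_names zero succ limit]:
  fixes \<alpha> :: "'v::zfc_universe"
  obtains "elts \<alpha> = {}" "L_level free sat \<alpha> = {}"
  | \<beta> where "is_succ \<beta> \<alpha>" "L_level free sat \<alpha> = definable_subsets free sat (L_level free sat \<beta>)"
  | "elts \<alpha> \<noteq> {}" "\<nexists>\<beta>. is_succ \<beta> \<alpha>" "L_level free sat \<alpha> = (\<Union>\<beta>\<in>elts \<alpha>. L_level free sat \<beta>)"
  using L_level_zero L_level_succ L_level_limit by metis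

text \<open>This lets separation form any definable subset of a level. A successor level sits inside
  a power set, and a limit level is a union obtained by replacement; at zero, \<alpha> itself is the
  empty set.\<close>

lemma L_level_is_set:
  fixes \<alpha> :: "'v::zfc_universe"
  shows "\<exists>m. elts m = L_level free sat \<alpha>"
proof (induction \<alpha> rule: mem_induct)
  case (mem \<alpha>)
  show ?case
  proof (cases rule: L_level_cases[where \<alpha> = \<alpha> and free = free and sat = sat])
    case zero
    then show ?thesis
      by metis
  next
    case (succ \<beta>)
    then obtain m where m: "elts m = L_level free sat \<beta>"
      using mem[of \<beta>] by (auto simp: is_succ_def)
    obtain p where "elts p = {z. elts z \<subseteq> elts m}"
      using power_set by blast
    then have "L_level free sat \<alpha> \<subseteq> elts p"
      unfolding succ(2) definable_subsets_def m by auto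
    then show ?thesis
      by (rule separation)
  next
    case limit
    obtain f where f: "\<And>\<beta>. \<beta> \<in> elts \<alpha> \<Longrightarrow> elts (f \<beta>) = L_level free sat \<beta>"
      using mem by metis
    obtain m where "elts m = f ` elts \<alpha>"
      using replacement by blast
    moreover obtain u where "elts u = (\<Union>z\<in>elts m. elts z)"
      using union by blast
    ultimately show ?thesis
      using f limit(3) by auto
  qed
qed

lemma finite_fv: "finite (fv \<phi>)"
  by (induction \<phi>) auto

lemma sat_cf_cong:
  "(\<And>v. v \<in> fv \<phi> \<Longrightarrow> s v = t v) \<Longrightarrow> sat_cf k M E s \<phi> \<longleftrightarrow> sat_cf k M E t \<phi>"
proof (induction \<phi> arbitrary: s t)
  case (Exi x \<phi>)
  have "sat_cf k M E (s(x := c)) \<phi> \<longleftrightarrow> sat_cf k M E (t(x := c)) \<phi>" for c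
    using Exi.prems by (intro Exi.IH) auto
  then show ?case
    by simp
next
  case (Qcf x y \<phi>)
  have "sat_cf k M E (s(x := c, y := d)) \<phi> \<longleftrightarrow> sat_cf k M E (t(x := c, y := d)) \<phi>" for c d
    using Qcf.prems by (intro Qcf.IH) auto
  then show ?case
    by simp
next
  case (And \<phi> \<psi>)
  have "sat_cf k M E s \<phi> \<longleftrightarrow> sat_cf k M E t \<phi>" "sat_cf k M E s \<psi> \<longleftrightarrow> sat_cf k M E t \<psi>"
    using And.prems by (auto intro!: And.IH)
  then show ?case
    by simp
next
  case (Neg \<phi>)
  have "sat_cf k M E s \<phi> \<longleftrightarrow> sat_cf k M E t \<phi>"
    using Neg.prems by (intro Neg.IH) auto
  then show ?case
    by simp
qed auto

lemma sat_cf_iso: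
  assumes inj: "inj_on f M"
    and E: "\<And>a b. a \<in> M \<Longrightarrow> b \<in> M \<Longrightarrow> (f a, f b) \<in> E' \<longleftrightarrow> (a, b) \<in> E"
  shows "s ` fv \<phi> \<subseteq> M \<Longrightarrow> sat_cf k (f ` M) E' (f \<circ> s) \<phi> \<longleftrightarrow> sat_cf k M E s \<phi>"
proof (induction \<phi> arbitrary: s)
  case (Mem x y)
  then show ?case
    using E by simp
next
  case (Equ x y)
  then show ?case
    using inj by (auto dest: inj_onD)
next
  case (Neg \<phi>)
  then show ?case
    by simp
next
  case (And \<phi> \<psi>)
  then show ?case
    by (simp add: image_Un)
next
  case (Exi x \<phi>)
  have "sat_cf k (f ` M) E' ((f \<circ> s)(x := f c)) \<phi> \<longleftrightarrow> sat_cf k M E (s(x := c)) \<phi>" if "c \<in> M" for c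
  proof -
    have "(s(x := c)) ` fv \<phi> \<subseteq> M"
      using Exi.prems that by auto
    from Exi.IH[OF this] show ?thesis
      by (simp only: fun_upd_comp)
  qed
  then show ?case
    unfolding sat_cf.simps by blast
next
  case (Qcf x y \<phi>)
  have *: "sat_cf k (f ` M) E' ((f \<circ> s)(x := f c, y := f d)) \<phi> \<longleftrightarrow>
      sat_cf k M E (s(x := c, y := d)) \<phi>" if "c \<in> M" "d \<in> M" for c d
  proof -
    have "(s(x := c, y := d)) ` fv \<phi> \<subseteq> M"
      using Qcf.prems that by auto
    from Qcf.IH[OF this] show ?thesis
      by (simp only: fun_upd_comp)
  qed
  define r where "r = {(c, d). c \<in> M \<and> d \<in> M \<and> sat_cf k M E (s(x := c, y := d)) \<phi>}"
  define r' where "r' = {(c, d). c \<in> f ` M \<and> d \<in> f ` M \<and>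
    sat_cf k (f ` M) E' ((f \<circ> s)(x := c, y := d)) \<phi>}"
  \<comment> \<open>The order defined in the image structure is the image of the order defined in
    \<open>M\<close>, which reduces the quantifier to invariance of cofinality under
    injections.\<close>
  have "r' = dir_image r f"
    unfolding r_def r'_def dir_image_def using * by auto
  moreover have "inj_on f (Field r)"
    using inj by (rule inj_on_subset) (auto simp: r_def Field_def)
  ultimately have "Linear_order r' \<and> has_cofinality r' k \<longleftrightarrow> Linear_order r \<and> has_cofinality r k"
    using cofinality_order_dir_image_iff by blast
  then show ?case
    by (simp only: sat_cf.simps Let_def r_def r'_def)
qed

abbreviation sat_mem :: "'k rel \<Rightarrow> 'v::zfc_universe set \<Rightarrow> (nat \<Rightarrow> 'v) \<Rightarrow> fm \<Rightarrow> bool" where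
  "sat_mem k M \<equiv> sat_cf k M (mem_rel \<inter> M \<times> M)"

abbreviation L_cf :: "'k rel \<Rightarrow> 'v::zfc_universe \<Rightarrow> 'v set" where
  "L_cf k \<equiv> L_level fv (sat_cf k)"

text \<open>Countability of the language bounds the number of definable subsets and the number of
  closure conditions on a hull.\<close>

instance fm :: countable
  by countable_datatype

text \<open>A formula, a distinguished variable and a finite list of parameter values determine the
  subset, and there are at most \<open>l\<close> such triples.\<close>

lemma card_definable_subsets:
  fixes M :: "'v::zfc_universe set"
  assumes l: "Cinfinite l" and M: "|M| \<le>o l"
  shows "|definable_subsets fv (sat_cf k) M| \<le>o l"
proof -
  define D where "D \<phi> x xs = {a \<in> M. sat_mem k M ((nth xs)(x := a)) \<phi>}" for \<phi> x xs
  \<comment> \<open>\<open>undefined\<close> fills the list positions that belong to no parameter.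
    It is adjoined because \<open>M\<close> may be empty.\<close>
  let ?I = "(UNIV :: (fm \<times> nat) set) \<times> lists (insert undefined M)"
  let ?D = "\<lambda>((\<phi>, x), xs). D \<phi> x xs"
  have sub: "elts ` definable_subsets fv (sat_cf k) M \<subseteq> ?D ` ?I"
  proof
    fix Y assume "Y \<in> elts ` definable_subsets fv (sat_cf k) M"
    then obtain \<phi> x s where s: "\<forall>v\<in>fv \<phi> - {x}. s v \<in> M"
      and Y: "Y = {a \<in> M. sat_mem k M (s(x := a)) \<phi>}"
      unfolding definable_subsets_def by blast
    obtain n where n: "\<And>v. v \<in> fv \<phi> \<Longrightarrow> v < n"
      using finite_fv[of \<phi>] finite_nat_set_iff_bounded by auto
    define xs where "xs = map (\<lambda>v. if v \<in> fv \<phi> - {x} then s v else undefined) [0..<n]"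
    have "Y = D \<phi> x xs"
      unfolding Y D_def
      by (intro Collect_cong conj_cong refl sat_cf_cong) (auto simp: xs_def n)
    moreover have "xs \<in> lists (insert undefined M)"
      using s by (auto simp: xs_def)
    ultimately show "Y \<in> ?D ` ?I"
      by (intro rev_image_eqI[of "((\<phi>, x), xs)"]) auto
  qed
  have fin: "\<not> finite (Field l)" "Card_order l"
    using l by (auto simp: cinfinite_def)
  have "|insert undefined M| \<le>o l"
    using Cinfinite_Un[OF l countable_ordLeq_Cinfinite[OF l, of "{undefined}"] M] by simp
  then have I: "|?I| \<le>o l"
    using fin by (intro card_of_Times_ordLeq_infinite_Field card_of_lists_ordLeq[OF l]
        countable_ordLeq_Cinfinite[OF l, of "UNIV :: (fm \<times> nat) set"]) auto
  have "inj_on elts (definable_subsets fv (sat_cf k) M)"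
    by (rule inj_onI) (rule extensionality)
  then have "|definable_subsets fv (sat_cf k) M| \<le>o |?D ` ?I|"
    by (rule card_of_ordLeqI) (rule subsetD[OF sub imageI])
  also have "|?D ` ?I| \<le>o |?I|"
    by (rule card_of_image)
  also note I
  finally show ?thesis .
qed

lemma card_L_level:
  fixes \<alpha> :: "'v::zfc_universe"
  assumes l: "Cinfinite l"
  shows "ordinal \<alpha> \<Longrightarrow> |elts \<alpha>| \<le>o l \<Longrightarrow> |L_cf k \<alpha>| \<le>o l"
proof (induction \<alpha> rule: mem_induct)
  case (mem \<alpha>)
  have IH: "|L_cf k \<beta>| \<le>o l" if "\<beta> \<in> elts \<alpha>" for \<beta>
  proof -
    have "elts \<beta> \<subseteq> elts \<alpha>"
      using that mem.prems(1) unfolding ordinal_def transitive_set_def by blast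
    then show ?thesis
      using mem.IH[OF that] ordinal_mem[OF mem.prems(1) that] ordLeq_subset mem.prems(2) by blast
  qed
  show ?case
  proof (cases rule: L_level_cases[where \<alpha> = \<alpha> and free = fv and sat = "sat_cf k"])
    case zero
    then show ?thesis
      using l by (simp add: countable_ordLeq_Cinfinite)
  next
    case (succ \<beta>)
    then show ?thesis
      using IH[of \<beta>] l by (simp add: is_succ_def card_definable_subsets)
  next
    case limit
    then show ?thesis
      using Cinfinite_UNION[OF l mem.prems(2) IH] by simp
  qed
qed

section \<open>Hulls\<close>

text \<open>
  If \<open>r\<close> has cofinality at most \<open>l\<close>, a cofinal set is absorbed and the cofinality of \<open>r\<close> is
  preserved. Otherwise every stage \<open>S\<close> of the chain is strictly bounded at a later stage, so that
  the cofinality of the restriction becomes \<open>cardSuc k\<close> and in particular is not \<open>k\<close>.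
\<close>

definition order_closed :: "'l rel \<Rightarrow> 'a rel \<Rightarrow> 'a set \<Rightarrow> 'a set \<Rightarrow> bool" where
  "order_closed l r S T \<longleftrightarrow>
     (\<not> Linear_order r \<longrightarrow> \<not> Linear_order (r \<inter> T \<times> T)) \<and>
     (if \<exists>A. cofinal_subset A r \<and> |A| \<le>o l then \<exists>A\<subseteq>T. cofinal_subset A r
      else \<exists>b\<in>T \<inter> Field r. \<forall>c\<in>S. (b, c) \<notin> r)"

text \<open>Few elements in \<open>T\<close> suffice: a small cofinal set or a single point, and
  finitely many points that witness a failure of linearity.\<close>

lemma order_closed_witness:
  assumes l: "Cinfinite l" and S: "|S| \<le>o l"
  shows "\<exists>W. |W| \<le>o l \<and> (\<forall>T. W \<subseteq> T \<longrightarrow> order_closed l r S T)"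
proof -
  obtain F where F: "finite F" "\<not> Linear_order r \<Longrightarrow> F \<subseteq> T \<Longrightarrow> \<not> Linear_order (r \<inter> T \<times> T)" for T
    using not_Linear_order_finite_witness[of r] by (cases "Linear_order r") blast+
  have F': "|F| \<le>o l"
    using l F(1) by (intro countable_ordLeq_Cinfinite countable_finite)
  show ?thesis
  proof (cases "\<exists>A. cofinal_subset A r \<and> |A| \<le>o l")
    case True
    then obtain A where A: "cofinal_subset A r \<and> |A| \<le>o l" ..
    then have "order_closed l r S T" if "F \<union> A \<subseteq> T" for T
      using that F(2)[of T] unfolding order_closed_def by auto
    moreover have "|F \<union> A| \<le>o l"
      using A by (intro Cinfinite_Un l F') simp
    ultimately show ?thesis
      by (intro exI[of _ "F \<union> A"]) simp
  next
    case False
    have "|S \<inter> Field r| \<le>o l"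
      using S by (rule ordLeq_subset[rotated]) simp
    \<comment> \<open>The stage \<open>S\<close> is too small to be cofinal, so some
      \<open>b\<close> is below no element of it; in a linear order \<open>b\<close> is a strict
      upper bound.\<close>
    then have "\<not> cofinal_subset (S \<inter> Field r) r"
      using False by (metis (no_types))
    then obtain b where b: "b \<in> Field r" "\<forall>c\<in>S \<inter> Field r. (b, c) \<notin> r"
      unfolding cofinal_subset_def by auto
    have b': "(b, c) \<notin> r" if "c \<in> S" for c
      using b(2) that FieldI2[of b c r] by auto
    have "order_closed l r S T" if "F \<union> {b} \<subseteq> T" for T
      unfolding order_closed_def if_not_P[OF False] using that F(2)[of T] b(1) b' by auto
    moreover have "|F \<union> {b}| \<le>o l"
      by (intro Cinfinite_Un l F' countable_ordLeq_Cinfinite) simp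
    ultimately show ?thesis
      by (intro exI[of _ "F \<union> {b}"]) simp
  qed
qed

lemma order_closed_preserves:
  fixes r :: "'a rel"
  assumes kl: "k \<le>o l"
    and N: "\<And>C. C \<subseteq> N \<Longrightarrow> |C| \<le>o k \<Longrightarrow> \<exists>S. C \<subseteq> S \<and> order_closed l r S N"
    and k: "Card_order k"
  shows "Linear_order (r \<inter> N \<times> N) \<and> has_cofinality (r \<inter> N \<times> N) k \<longleftrightarrow>
         Linear_order r \<and> has_cofinality r k"
proof -
  have "|{} :: 'a set| \<le>o k"
    using k card_of_empty1 by blast
  then obtain S where S: "order_closed l r S N"
    using N[of "{}"] by auto
  show ?thesis
  proof (cases "Linear_order r")
    case False
    then show ?thesis
      using S unfolding order_closed_def by simp
  next
    case True
    then have r: "Refl r" "trans r"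
      by (auto simp: order_on_defs)
    have LN: "Linear_order (r \<inter> N \<times> N)"
      using True by (rule Linear_order_Restr)
    show ?thesis
    proof (cases "\<exists>A. cofinal_subset A r \<and> |A| \<le>o l")
      case True
      then obtain A where "A \<subseteq> N" "cofinal_subset A r"
        using S unfolding order_closed_def by auto
      then show ?thesis
        using has_cofinality_restrict[OF r] \<open>Linear_order r\<close> LN by metis
    next
      case False
      have "\<not> has_cofinality r k"
      proof
        assume "has_cofinality r k"
        then obtain A where "cofinal_subset A r" "|A| =o k"
          unfolding has_cofinality_def by auto
        then show False
          using False kl ordIso_ordLeq_trans by metis
      qed
      moreover have "\<not> has_cofinality (r \<inter> N \<times> N) k"
      proof
        assume "has_cofinality (r \<inter> N \<times> N) k"
        \<comment> \<open>Some stage contains \<open>C\<close>, and a point \<open>b\<close> of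
          \<open>N\<close> lies beyond that stage, so \<open>C\<close> cannot be cofinal in the
          restriction.\<close>
        then obtain C where C: "cofinal_subset C (r \<inter> N \<times> N)" "|C| =o k"
          unfolding has_cofinality_def by auto
        have "C \<subseteq> N"
          using C(1) unfolding cofinal_subset_def Field_restrict[OF r(1)] by simp
        then obtain S where S: "C \<subseteq> S" "order_closed l r S N"
          using N[of C] C(2) ordIso_imp_ordLeq by metis
        then obtain b where b: "b \<in> N" "b \<in> Field r" "\<forall>c\<in>S. (b, c) \<notin> r"
          unfolding order_closed_def if_not_P[OF False] by auto
        then obtain c where "c \<in> C" "(b, c) \<in> r"
          using C(1) unfolding cofinal_subset_def Field_restrict[OF r(1)] by blast
        then show False
          using b(3) S(1) by auto
      qed
      ultimately show ?thesis
        by simp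
    qed
  qed
qed

abbreviation L_order :: "'k rel \<Rightarrow> 'v::zfc_universe \<Rightarrow> (nat \<Rightarrow> 'v) \<Rightarrow> nat \<Rightarrow> nat \<Rightarrow> fm \<Rightarrow> 'v rel" where
  "L_order k \<beta> s x y \<phi> \<equiv>
     {(c, d). c \<in> L_cf k \<beta> \<and> d \<in> L_cf k \<beta> \<and> sat_mem k (L_cf k \<beta>) (s(x := c, y := d)) \<phi>}"

text \<open>
  A substitute for an elementary submodel of a large \<open>H(\<theta>)\<close>: only those Skolem functions are
  kept that make the collapse of \<open>N\<close> map levels to levels, so that neither formulas nor
  satisfaction have to be coded inside the universe.
\<close>

locale cf_hull =
  fixes k :: "'k rel" and N :: "'v::zfc_universe set"
  assumes extensional: "x \<in> N \<Longrightarrow> y \<in> N \<Longrightarrow> (z \<in> elts x) \<noteq> (z \<in> elts y) \<Longrightarrow>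
      \<exists>z\<in>N. (z \<in> elts x) \<noteq> (z \<in> elts y)"
    and member: "x \<in> N \<Longrightarrow> elts x \<noteq> {} \<Longrightarrow> elts x \<inter> N \<noteq> {}"
    and predecessor: "\<alpha> \<in> N \<Longrightarrow> is_succ \<beta> \<alpha> \<Longrightarrow> \<beta> \<in> N"
    and between: "\<alpha> \<in> N \<Longrightarrow> \<beta> \<in> N \<Longrightarrow> \<gamma> \<in> elts \<alpha> \<Longrightarrow> \<beta> \<in> elts \<gamma> \<Longrightarrow>
      \<exists>\<gamma>\<in>elts \<alpha> \<inter> N. \<beta> \<in> elts \<gamma>"
    and level: "\<alpha> \<in> N \<Longrightarrow> x \<in> N \<Longrightarrow> \<beta> \<in> elts \<alpha> \<Longrightarrow> x \<in> L_cf k \<beta> \<Longrightarrow>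
      \<exists>\<beta>\<in>elts \<alpha> \<inter> N. x \<in> L_cf k \<beta>"
    and comprehension: "\<beta> \<in> N \<Longrightarrow> s ` (fv \<phi> - {i}) \<subseteq> N \<Longrightarrow>
      elts y = {a \<in> L_cf k \<beta>. sat_mem k (L_cf k \<beta>) (s(i := a)) \<phi>} \<Longrightarrow> y \<in> N"
    and parameters: "\<beta> \<in> N \<Longrightarrow> y \<in> N \<Longrightarrow> y \<in> definable_subsets fv (sat_cf k) (L_cf k \<beta>) \<Longrightarrow>
      \<exists>\<phi> i s. s ` (fv \<phi> - {i}) \<subseteq> L_cf k \<beta> \<inter> N \<and>
        elts y = {a \<in> L_cf k \<beta>. sat_mem k (L_cf k \<beta>) (s(i := a)) \<phi>}"
    and witness: "\<beta> \<in> N \<Longrightarrow> s ` (fv \<phi> - {i}) \<subseteq> N \<Longrightarrow>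
      c \<in> L_cf k \<beta> \<Longrightarrow> sat_mem k (L_cf k \<beta>) (s(i := c)) \<phi> \<Longrightarrow>
      \<exists>c\<in>L_cf k \<beta> \<inter> N. sat_mem k (L_cf k \<beta>) (s(i := c)) \<phi>"
    and cofinality: "\<beta> \<in> N \<Longrightarrow> s ` (fv \<phi> - {i, j}) \<subseteq> N \<Longrightarrow> r = L_order k \<beta> s i j \<phi> \<Longrightarrow>
      Linear_order (r \<inter> N \<times> N) \<and> has_cofinality (r \<inter> N \<times> N) k \<longleftrightarrow>
      Linear_order r \<and> has_cofinality r k"

section \<open>Existence of hulls\<close>

text \<open>Closure conditions take finite lists while formulas take assignments, so the finitely
  many relevant values are coded by a list. The other entries are filled with \<beta>, which is
  known to lie in \<open>N\<close>.\<close>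

lemma parameter_list:
  assumes "\<beta> \<in> N" "s ` (fv \<phi> - X) \<subseteq> N"
  shows "\<exists>ys. set ys \<subseteq> N \<and> (\<forall>v\<in>fv \<phi> - X. ys ! v = s v)"
proof -
  obtain n where n: "\<And>v. v \<in> fv \<phi> \<Longrightarrow> v < n"
    using finite_fv[of \<phi>] finite_nat_set_iff_bounded by auto
  define ys where "ys = map (\<lambda>v. if v \<in> fv \<phi> - X then s v else \<beta>) [0..<n]"
  have "set ys \<subseteq> N"
    using assms by (auto simp: ys_def)
  moreover have "\<forall>v\<in>fv \<phi> - X. ys ! v = s v"
    using n by (simp add: ys_def)
  ultimately show ?thesis
    by blast
qed

text \<open>Each clause of \<open>cf_hull\<close> follows from closure conditions of two kinds: a
  finite witness set is included in the hull, or a definable order is \<open>order_closed\<close>.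
  Levels and parameters enter through the list \<open>xs\<close>, so the conditions are indexed by
  formulas and variables and are countably many.\<close>

lemma cf_hull_exists:
  fixes k :: "'k rel" and l :: "'l rel" and B :: "'v::zfc_universe set"
  assumes k: "Cinfinite k" and l: "Card_order l" and kl: "cardSuc k \<le>o l"
    and B: "|B| \<le>o l"
  shows "\<exists>N. B \<subseteq> N \<and> |N| \<le>o l \<and> cf_hull k N"
proof -
  have lI: "Cinfinite l"
    using Cinfinite_cardSuc[OF k] kl l cinfinite_mono by blast
  have kl': "k \<le>o l"
    using cardSuc_ordLeq k kl ordLeq_transitive by blast
  \<comment> \<open>Witnesses are finite sets rather than points because \<open>Q\<^sub>6\<close>
    asks for all parameters of one definition at once.\<close>
  define wit :: "('v list \<Rightarrow> 'v set \<Rightarrow> bool) \<Rightarrow> 'v list \<Rightarrow> 'v set \<Rightarrow> 'v set \<Rightarrow> bool"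
    where "wit Q xs S T \<longleftrightarrow> ((\<exists>F. finite F \<and> Q xs F) \<longrightarrow> (\<exists>F\<subseteq>T. Q xs F))" for Q xs S T
  define Q\<^sub>1 :: "'v list \<Rightarrow> 'v set \<Rightarrow> bool" where
    "Q\<^sub>1 xs F \<longleftrightarrow> (\<exists>z\<in>F. (z \<in> elts (xs ! 0)) \<noteq> (z \<in> elts (xs ! 1)))" for xs F
  define Q\<^sub>2 :: "'v list \<Rightarrow> 'v set \<Rightarrow> bool" where
    "Q\<^sub>2 xs F \<longleftrightarrow> (\<exists>z\<in>F. z \<in> elts (xs ! 0))" for xs F
  define Q\<^sub>3 :: "'v list \<Rightarrow> 'v set \<Rightarrow> bool" where
    "Q\<^sub>3 xs F \<longleftrightarrow> (\<exists>z\<in>F. is_succ z (xs ! 0))" for xs F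
  define Q\<^sub>4 :: "'v list \<Rightarrow> 'v set \<Rightarrow> bool" where
    "Q\<^sub>4 xs F \<longleftrightarrow> (\<exists>z\<in>F. z \<in> elts (xs ! 0) \<and> xs ! 1 \<in> elts z)" for xs F
  define Q\<^sub>5 :: "'v list \<Rightarrow> 'v set \<Rightarrow> bool" where
    "Q\<^sub>5 xs F \<longleftrightarrow> (\<exists>z\<in>F. z \<in> elts (xs ! 0) \<and> xs ! 1 \<in> L_cf k z)" for xs F
  define Q\<^sub>6 :: "'v list \<Rightarrow> 'v set \<Rightarrow> bool" where
    "Q\<^sub>6 xs F \<longleftrightarrow> (\<exists>\<phi> x s. F = s ` (fv \<phi> - {x}) \<and> s ` (fv \<phi> - {x}) \<subseteq> L_cf k (xs ! 0) \<and>
        elts (xs ! 1) = {a \<in> L_cf k (xs ! 0). sat_mem k (L_cf k (xs ! 0)) (s(x := a)) \<phi>})" for xs F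
  define Q\<^sub>7 :: "fm \<times> nat \<Rightarrow> 'v list \<Rightarrow> 'v set \<Rightarrow> bool" where
    "Q\<^sub>7 = (\<lambda>(\<phi>, x) xs F. \<exists>z\<in>F. elts z =
        {a \<in> L_cf k (hd xs). sat_mem k (L_cf k (hd xs)) ((nth (tl xs))(x := a)) \<phi>})"
  define Q\<^sub>8 :: "fm \<times> nat \<Rightarrow> 'v list \<Rightarrow> 'v set \<Rightarrow> bool" where
    "Q\<^sub>8 = (\<lambda>(\<phi>, x) xs F. \<exists>z\<in>F. z \<in> L_cf k (hd xs) \<and>
        sat_mem k (L_cf k (hd xs)) ((nth (tl xs))(x := z)) \<phi>)"
  define P :: "fm \<times> nat \<times> nat \<Rightarrow> 'v list \<Rightarrow> 'v set \<Rightarrow> 'v set \<Rightarrow> bool" where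
    "P = (\<lambda>(\<phi>, x, y) xs. order_closed l (L_order k (hd xs) (nth (tl xs)) x y \<phi>))"
  define I where "I = wit ` ({Q\<^sub>1, Q\<^sub>2, Q\<^sub>3, Q\<^sub>4, Q\<^sub>5, Q\<^sub>6} \<union> range Q\<^sub>7 \<union> range Q\<^sub>8) \<union> range P"
  have "countable I"
    unfolding I_def by (intro countable_Un countable_image) auto
  then have I: "|I| \<le>o l"
    by (rule countable_ordLeq_Cinfinite[OF lI])
  have "\<exists>N. B \<subseteq> N \<and> |N| \<le>o l \<and> (\<forall>R\<in>I. \<forall>xs C. set xs \<subseteq> N \<longrightarrow> C \<subseteq> N \<longrightarrow> |C| \<le>o k \<longrightarrow>
      (\<exists>S. C \<subseteq> S \<and> R xs S N))"
  proof (rule closure_under_conditions[OF k l kl I _ B])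
    fix R and xs :: "'v list" and S assume "R \<in> I" "set xs \<subseteq> S" and S: "|S| \<le>o l"
    consider Q where "R = wit Q" | \<phi> x y where "R = P (\<phi>, x, y)"
      using \<open>R \<in> I\<close> unfolding I_def by auto
    then show "\<exists>W. |W| \<le>o l \<and> (\<forall>T. W \<subseteq> T \<longrightarrow> R xs S T)"
    proof cases
      case 1
      show ?thesis
      proof (cases "\<exists>F. finite F \<and> Q xs F")
        case True
        then obtain F where F: "finite F" "Q xs F"
          by auto
        then have "|F| \<le>o l"
          by (intro countable_ordLeq_Cinfinite[OF lI] countable_finite)
        then show ?thesis
          using F 1 by (intro exI[of _ F]) (auto simp: wit_def)
      next
        case False
        have "|{} :: 'v set| \<le>o l"
          by (intro countable_ordLeq_Cinfinite[OF lI]) simp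
        then show ?thesis
          using False 1 by (intro exI[of _ "{}"]) (auto simp: wit_def)
      qed
    next
      case 2
      then show ?thesis
        using order_closed_witness[OF lI S] by (simp add: P_def)
    qed
  qed
  then obtain N where
    N: "B \<subseteq> N \<and> |N| \<le>o l \<and> (\<forall>R\<in>I. \<forall>xs C. set xs \<subseteq> N \<longrightarrow> C \<subseteq> N \<longrightarrow> |C| \<le>o k \<longrightarrow>
      (\<exists>S. C \<subseteq> S \<and> R xs S N))" ..
  have closed: "\<exists>F\<subseteq>N. Q xs F"
    if "Q \<in> {Q\<^sub>1, Q\<^sub>2, Q\<^sub>3, Q\<^sub>4, Q\<^sub>5, Q\<^sub>6} \<union> range Q\<^sub>7 \<union> range Q\<^sub>8"
      "set xs \<subseteq> N" "Q xs F" "finite F" for Q xs F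
  proof -
    \<comment> \<open>A condition \<open>wit Q\<close> does not depend on the stage, so it is
      extracted with the empty set as \<open>C\<close>.\<close>
    have "|{} :: 'v set| \<le>o k"
      by (intro countable_ordLeq_Cinfinite[OF k]) simp
    moreover have "wit Q \<in> I"
      using that(1) unfolding I_def by (rule UnI1[OF imageI])
    ultimately have "\<exists>S. wit Q xs S N"
      using N that(2) by (metis empty_subsetI)
    then show ?thesis
      using that(3,4) unfolding wit_def by auto
  qed
  have "cf_hull k N"
  proof
    fix x y z assume "x \<in> N" "y \<in> N" "(z \<in> elts x) \<noteq> (z \<in> elts y)"
    then show "\<exists>z\<in>N. (z \<in> elts x) \<noteq> (z \<in> elts y)"
      using closed[of Q\<^sub>1 "[x, y]" "{z}"] by (auto simp: Q\<^sub>1_def)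
  next
    fix x assume "x \<in> N" "elts x \<noteq> {}"
    moreover then obtain z where "z \<in> elts x"
      by auto
    ultimately show "elts x \<inter> N \<noteq> {}"
      using closed[of Q\<^sub>2 "[x]" "{z}"] by (auto simp: Q\<^sub>2_def)
  next
    fix \<alpha> \<beta> assume "\<alpha> \<in> N" "is_succ \<beta> \<alpha>"
    moreover from this obtain \<beta>' where "\<beta>' \<in> N" "is_succ \<beta>' \<alpha>"
      using closed[of Q\<^sub>3 "[\<alpha>]" "{\<beta>}"] by (auto simp: Q\<^sub>3_def)
    ultimately show "\<beta> \<in> N"
      using is_succ_unique by metis
  next
    fix \<alpha> \<beta> \<gamma> assume "\<alpha> \<in> N" "\<beta> \<in> N" "\<gamma> \<in> elts \<alpha>" "\<beta> \<in> elts \<gamma>"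
    then show "\<exists>\<gamma>\<in>elts \<alpha> \<inter> N. \<beta> \<in> elts \<gamma>"
      using closed[of Q\<^sub>4 "[\<alpha>, \<beta>]" "{\<gamma>}"] by (auto simp: Q\<^sub>4_def)
  next
    fix \<alpha> x \<beta> assume "\<alpha> \<in> N" "x \<in> N" "\<beta> \<in> elts \<alpha>" "x \<in> L_cf k \<beta>"
    then show "\<exists>\<beta>\<in>elts \<alpha> \<inter> N. x \<in> L_cf k \<beta>"
      using closed[of Q\<^sub>5 "[\<alpha>, x]" "{\<beta>}"] by (auto simp: Q\<^sub>5_def)
  next
    fix \<beta> s \<phi> x y
    assume \<beta>: "\<beta> \<in> N" and s: "s ` (fv \<phi> - {x}) \<subseteq> N"
      and y: "elts y = {a \<in> L_cf k \<beta>. sat_mem k (L_cf k \<beta>) (s(x := a)) \<phi>}"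
    obtain ys where ys: "set ys \<subseteq> N" "\<forall>v\<in>fv \<phi> - {x}. ys ! v = s v"
      using parameter_list[OF \<beta> s] by auto
    \<comment> \<open>Both assignments define the same set, so a witness for
      \<open>Q\<^sub>7\<close> has the elements of \<open>y\<close> and equals \<open>y\<close> by
      extensionality.\<close>
    have "sat_mem k (L_cf k \<beta>) (s(x := a)) \<phi> \<longleftrightarrow> sat_mem k (L_cf k \<beta>) ((nth ys)(x := a)) \<phi>" for a
      using ys(2) by (intro sat_cf_cong) auto
    then have *: "Q\<^sub>7 (\<phi>, x) (\<beta> # ys) F \<longleftrightarrow> (\<exists>z\<in>F. elts z = elts y)" for F
      by (simp add: Q\<^sub>7_def y)
    have "\<exists>F\<subseteq>N. Q\<^sub>7 (\<phi>, x) (\<beta> # ys) F"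
      using \<beta> ys(1) by (intro closed[of _ _ "{y}"]) (auto simp: *)
    then show "y \<in> N"
      unfolding * using extensionality by auto
  next
    fix \<beta> y assume N': "\<beta> \<in> N" "y \<in> N" and "y \<in> definable_subsets fv (sat_cf k) (L_cf k \<beta>)"
    then obtain \<phi> x s where "\<forall>v\<in>fv \<phi> - {x}. s v \<in> L_cf k \<beta>"
      "elts y = {a \<in> L_cf k \<beta>. sat_mem k (L_cf k \<beta>) (s(x := a)) \<phi>}"
      unfolding definable_subsets_def by auto
    then have "Q\<^sub>6 [\<beta>, y] (s ` (fv \<phi> - {x}))"
      unfolding Q\<^sub>6_def by (intro exI[of _ \<phi>] exI[of _ x] exI[of _ s]) auto
    then have "\<exists>F\<subseteq>N. Q\<^sub>6 [\<beta>, y] F"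
      using N' finite_fv by (intro closed) auto
    then show "\<exists>\<phi> x s. s ` (fv \<phi> - {x}) \<subseteq> L_cf k \<beta> \<inter> N \<and>
        elts y = {a \<in> L_cf k \<beta>. sat_mem k (L_cf k \<beta>) (s(x := a)) \<phi>}"
      by (auto simp: Q\<^sub>6_def)
  next
    fix \<beta> s \<phi> x c
    assume \<beta>: "\<beta> \<in> N" and s: "s ` (fv \<phi> - {x}) \<subseteq> N"
      and c: "c \<in> L_cf k \<beta>" "sat_mem k (L_cf k \<beta>) (s(x := c)) \<phi>"
    obtain ys where ys: "set ys \<subseteq> N" "\<forall>v\<in>fv \<phi> - {x}. ys ! v = s v"
      using parameter_list[OF \<beta> s] by auto
    have "sat_mem k (L_cf k \<beta>) (s(x := a)) \<phi> \<longleftrightarrow> sat_mem k (L_cf k \<beta>) ((nth ys)(x := a)) \<phi>" for a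
      using ys(2) by (intro sat_cf_cong) auto
    then have *: "Q\<^sub>8 (\<phi>, x) (\<beta> # ys) F \<longleftrightarrow>
        (\<exists>z\<in>F. z \<in> L_cf k \<beta> \<and> sat_mem k (L_cf k \<beta>) (s(x := z)) \<phi>)" for F
      by (simp add: Q\<^sub>8_def)
    have "\<exists>F\<subseteq>N. Q\<^sub>8 (\<phi>, x) (\<beta> # ys) F"
      using \<beta> ys(1) c by (intro closed[of _ _ "{c}"]) (auto simp: *)
    then show "\<exists>c\<in>L_cf k \<beta> \<inter> N. sat_mem k (L_cf k \<beta>) (s(x := c)) \<phi>"
      unfolding * by auto
  next
    fix \<beta> s \<phi> x y and r :: "'v rel"
    assume \<beta>: "\<beta> \<in> N" and s: "s ` (fv \<phi> - {x, y}) \<subseteq> N" and r: "r = L_order k \<beta> s x y \<phi>"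
    obtain ys where ys: "set ys \<subseteq> N" "\<forall>v\<in>fv \<phi> - {x, y}. ys ! v = s v"
      using parameter_list[OF \<beta> s] by auto
    have "sat_mem k (L_cf k \<beta>) (s(x := c, y := d)) \<phi> \<longleftrightarrow>
        sat_mem k (L_cf k \<beta>) ((nth ys)(x := c, y := d)) \<phi>" for c d
      using ys(2) by (intro sat_cf_cong) auto
    then have *: "P (\<phi>, x, y) (\<beta> # ys) = order_closed l r"
      by (simp add: P_def r)
    have "P (\<phi>, x, y) \<in> I" "set (\<beta> # ys) \<subseteq> N"
      using \<beta> ys(1) by (auto simp: I_def)
    \<comment> \<open>Here the stage matters: every small \<open>C\<close> has to be caught by one,
      as \<open>order_closed_preserves\<close> demands.\<close>
    then have "\<exists>S. C \<subseteq> S \<and> order_closed l r S N" if "C \<subseteq> N" "|C| \<le>o k" for C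
      using N that unfolding *[symmetric] by metis
    then show "Linear_order (r \<inter> N \<times> N) \<and> has_cofinality (r \<inter> N \<times> N) k \<longleftrightarrow>
      Linear_order r \<and> has_cofinality r k"
      using k by (intro order_closed_preserves[OF kl']) auto
  qed
  then show ?thesis
    using N by (intro exI[of _ N]) simp
qed

section \<open>The collapse of a hull\<close>

text \<open>The Mostowski collapse of \<open>N\<close>, also defined at arguments outside
  \<open>N\<close>. The choice operator names the set with the given elements, which exists by
  separation and replacement.\<close>

definition collapse :: "'v::zfc_universe set \<Rightarrow> 'v \<Rightarrow> 'v" where
  "collapse N = wfrec mem_rel (\<lambda>f x. SOME y. elts y = f ` (elts x \<inter> N))"

lemma elts_collapse: "elts (collapse N x) = collapse N ` (elts x \<inter> N)"
proof -
  have cut: "cut (collapse N) mem_rel x ` (elts x \<inter> N) = collapse N ` (elts x \<inter> N)"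
    by (intro image_cong refl) (auto simp: cut_apply mem_rel_def)
  have "collapse N x = (SOME y. elts y = cut (collapse N) mem_rel x ` (elts x \<inter> N))"
    unfolding collapse_def by (subst wfrec[OF wf_mem_rel]) simp
  then have *: "collapse N x = (SOME y. elts y = collapse N ` (elts x \<inter> N))"
    unfolding cut .
  obtain u where u: "elts u = elts x \<inter> N"
    using separation[of "elts x \<inter> N" x] by auto
  show ?thesis
    unfolding * using replacement[of "collapse N" u] unfolding u by (rule someI_ex)
qed

text \<open>A member of a member of the collapse is the image of a member of a member inside
  \<open>N\<close>, so transitivity passes to the collapse and to its elements.\<close>

lemma ordinal_collapse:
  assumes "ordinal \<alpha>"
  shows "ordinal (collapse N \<alpha>)"
proof -
  have "transitive_set (collapse N \<beta>)" if "transitive_set \<beta>" for \<beta>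
    using that unfolding transitive_set_def by (fastforce simp: elts_collapse)
  then show ?thesis
    using assms unfolding ordinal_def by (auto simp: elts_collapse)
qed

text \<open>Everything reached from \<open>x\<close> by membership lies in \<delta> and hence in
  \<open>N\<close>, so the recursion discards nothing. This keeps a subset of \<delta> in
  place.\<close>

lemma collapse_fixes_transitive:
  fixes \<delta> :: "'v::zfc_universe"
  assumes "transitive_set \<delta>" "elts \<delta> \<subseteq> N"
  shows "elts x \<subseteq> elts \<delta> \<Longrightarrow> collapse N x = x"
proof (induction x rule: mem_induct)
  case (mem x)
  have "collapse N y = y" if "y \<in> elts x" for y
    using mem that assms(1) unfolding transitive_set_def by blast
  then have "elts (collapse N x) = elts x"
    using mem.prems assms(2) unfolding elts_collapse by force
  then show ?case
    by (rule extensionality)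
qed

section \<open>Levels under the collapse of a hull\<close>

context cf_hull
begin

text \<open>A Tarski-Vaught argument for the extended logic: \<open>witness\<close> handles the
  existential quantifier and \<open>cofinality\<close> handles \<open>Qcf\<close>.\<close>

lemma sat_hull:
  assumes \<beta>: "\<beta> \<in> N"
  shows "s ` fv \<phi> \<subseteq> L_cf k \<beta> \<inter> N \<Longrightarrow>
    sat_mem k (L_cf k \<beta> \<inter> N) s \<phi> \<longleftrightarrow> sat_mem k (L_cf k \<beta>) s \<phi>"
proof (induction \<phi> arbitrary: s)
  case (And \<phi> \<psi>)
  then show ?case
    by (simp add: image_Un)
next
  case (Exi x \<phi>)
  have IH: "sat_mem k (L_cf k \<beta> \<inter> N) (s(x := c)) \<phi> \<longleftrightarrow> sat_mem k (L_cf k \<beta>) (s(x := c)) \<phi>"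
    if "c \<in> L_cf k \<beta> \<inter> N" for c
    using Exi.prems that by (intro Exi.IH) auto
  have "s ` (fv \<phi> - {x}) \<subseteq> N"
    using Exi.prems by auto
  from witness[OF \<beta> this] show ?case
    unfolding sat_cf.simps using IH by blast
next
  case (Qcf x y \<phi>)
  define r where "r = L_order k \<beta> s x y \<phi>"
  have IH: "sat_mem k (L_cf k \<beta> \<inter> N) (s(x := c, y := d)) \<phi> \<longleftrightarrow>
      sat_mem k (L_cf k \<beta>) (s(x := c, y := d)) \<phi>"
    if "c \<in> L_cf k \<beta> \<inter> N" "d \<in> L_cf k \<beta> \<inter> N" for c d
    using Qcf.prems that by (intro Qcf.IH) auto
  \<comment> \<open>By induction the order defined inside the hull is the trace on \<open>N\<close>
    of the order defined in the full level.\<close>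
  have "{(c, d). c \<in> L_cf k \<beta> \<inter> N \<and> d \<in> L_cf k \<beta> \<inter> N \<and>
      sat_mem k (L_cf k \<beta> \<inter> N) (s(x := c, y := d)) \<phi>} = r \<inter> N \<times> N"
    unfolding r_def using IH by blast
  moreover have "s ` (fv \<phi> - {x, y}) \<subseteq> N"
    using Qcf.prems by auto
  ultimately show ?case
    using cofinality[OF \<beta> _ r_def] unfolding sat_cf.simps Let_def r_def[symmetric] by simp
qed auto

text \<open>By \<open>extensional\<close>, distinct elements of \<open>N\<close> differ by an
  element of \<open>N\<close>, and the induction hypothesis prevents the collapse from hiding that
  difference.\<close>

lemma collapse_inj: "x \<in> N \<Longrightarrow> y \<in> N \<Longrightarrow> collapse N x = collapse N y \<Longrightarrow> x = y"
proof (induction x arbitrary: y rule: mem_induct)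
  case (mem x)
  show ?case
  proof (rule ccontr)
    assume "x \<noteq> y"
    then have "elts x \<noteq> elts y"
      using extensionality by auto
    then obtain u where "(u \<in> elts x) \<noteq> (u \<in> elts y)"
      by auto
    from extensional[OF mem.prems(1,2) this] obtain z
      where z: "z \<in> N" "(z \<in> elts x) \<noteq> (z \<in> elts y)" ..
    have eq: "collapse N ` (elts x \<inter> N) = collapse N ` (elts y \<inter> N)"
      using mem.prems(3) elts_collapse by metis
    show False
    proof (cases "z \<in> elts x")
      case True
      then obtain z' where "z' \<in> elts y \<inter> N" "collapse N z = collapse N z'"
        using eq z(1) by blast
      then show False
        using mem.IH[OF True, of z'] z True by blast
    next
      case False
      then have "collapse N z \<in> collapse N ` (elts x \<inter> N)"
        using eq z by simp
      then obtain z' where "z' \<in> elts x" "z' \<in> N" "collapse N z' = collapse N z"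
        by auto
      then show False
        using mem.IH[of z' z] z(1) False by simp
    qed
  qed
qed

lemma collapse_mem_iff:
  assumes "x \<in> N" "y \<in> N"
  shows "collapse N x \<in> elts (collapse N y) \<longleftrightarrow> x \<in> elts y"
proof
  assume "collapse N x \<in> elts (collapse N y)"
  then obtain z where "z \<in> elts y" "z \<in> N" "collapse N x = collapse N z"
    unfolding elts_collapse by auto
  then show "x \<in> elts y"
    using collapse_inj[of x z] assms(1) by simp
next
  assume "x \<in> elts y"
  then show "collapse N x \<in> elts (collapse N y)"
    unfolding elts_collapse using assms(1) by simp
qed

text \<open>By \<open>L\<close> the collapse is an isomorphism from the trace of the level on
  \<open>N\<close> onto the level at the collapsed index, and the trace is elementary by
  \<open>sat_hull\<close>.\<close>

lemma sat_collapse: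
  assumes \<beta>: "\<beta> \<in> N" and L: "collapse N ` (L_cf k \<beta> \<inter> N) = L_cf k (collapse N \<beta>)"
    and s: "s ` fv \<phi> \<subseteq> L_cf k \<beta> \<inter> N"
  shows "sat_mem k (L_cf k (collapse N \<beta>)) (collapse N \<circ> s) \<phi> \<longleftrightarrow> sat_mem k (L_cf k \<beta>) s \<phi>"
proof -
  have "inj_on (collapse N) (L_cf k \<beta> \<inter> N)"
    using collapse_inj by (auto intro: inj_onI)
  then have "sat_mem k (L_cf k (collapse N \<beta>)) (collapse N \<circ> s) \<phi> \<longleftrightarrow>
      sat_mem k (L_cf k \<beta> \<inter> N) s \<phi>"
    unfolding L[symmetric] using s
    by (intro sat_cf_iso) (auto simp: mem_rel_def collapse_mem_iff)
  then show ?thesis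
    using sat_hull[OF \<beta> s] by simp
qed

text \<open>The successor step for levels. A definition and its collapse use the same formula:
  \<open>parameters\<close> supplies parameters that lie in \<open>N\<close>, and
  \<open>comprehension\<close> puts the set defined from pulled-back parameters into
  \<open>N\<close>.\<close>

lemma collapse_definable_subsets:
  assumes \<beta>: "\<beta> \<in> N" and L: "collapse N ` (L_cf k \<beta> \<inter> N) = L_cf k (collapse N \<beta>)"
  shows "collapse N ` (definable_subsets fv (sat_cf k) (L_cf k \<beta>) \<inter> N) =
    definable_subsets fv (sat_cf k) (L_cf k (collapse N \<beta>))"
proof -
  have *: "elts (collapse N y) = {a \<in> L_cf k (collapse N \<beta>).
      sat_mem k (L_cf k (collapse N \<beta>)) ((collapse N \<circ> s)(x := a)) \<phi>}"
    if s: "s ` (fv \<phi> - {x}) \<subseteq> L_cf k \<beta> \<inter> N"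
      and y: "elts y = {a \<in> L_cf k \<beta>. sat_mem k (L_cf k \<beta>) (s(x := a)) \<phi>}" for y \<phi> x s
  proof -
    have "sat_mem k (L_cf k (collapse N \<beta>)) ((collapse N \<circ> s)(x := collapse N a)) \<phi> \<longleftrightarrow>
        sat_mem k (L_cf k \<beta>) (s(x := a)) \<phi>" if "a \<in> L_cf k \<beta> \<inter> N" for a
    proof -
      have "(s(x := a)) ` fv \<phi> \<subseteq> L_cf k \<beta> \<inter> N"
        using s that by auto
      from sat_collapse[OF \<beta> L this] show ?thesis
        by (simp only: fun_upd_comp)
    qed
    then show ?thesis
      unfolding elts_collapse y L[symmetric] by blast
  qed
  show ?thesis
  proof (intro subset_antisym subsetI)
    fix z assume "z \<in> collapse N ` (definable_subsets fv (sat_cf k) (L_cf k \<beta>) \<inter> N)"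
    then obtain y where y: "z = collapse N y" "y \<in> N"
      "y \<in> definable_subsets fv (sat_cf k) (L_cf k \<beta>)"
      by blast
    obtain \<phi> x s where s: "s ` (fv \<phi> - {x}) \<subseteq> L_cf k \<beta> \<inter> N"
      "elts y = {a \<in> L_cf k \<beta>. sat_mem k (L_cf k \<beta>) (s(x := a)) \<phi>}"
      using parameters[OF \<beta> y(2,3)] by blast
    have "\<forall>v\<in>fv \<phi> - {x}. (collapse N \<circ> s) v \<in> L_cf k (collapse N \<beta>)"
      using s(1) unfolding L[symmetric] by auto
    then show "z \<in> definable_subsets fv (sat_cf k) (L_cf k (collapse N \<beta>))"
      using *[OF s] unfolding definable_subsets_def y(1) by blast
  next
    fix z assume "z \<in> definable_subsets fv (sat_cf k) (L_cf k (collapse N \<beta>))"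
    then obtain \<phi> x t where t: "\<forall>v\<in>fv \<phi> - {x}. t v \<in> L_cf k (collapse N \<beta>)"
      "elts z = {a \<in> L_cf k (collapse N \<beta>). sat_mem k (L_cf k (collapse N \<beta>)) (t(x := a)) \<phi>}"
      unfolding definable_subsets_def by blast
    have "\<forall>v\<in>fv \<phi> - {x}. \<exists>a. a \<in> L_cf k \<beta> \<inter> N \<and> t v = collapse N a"
      using t(1) unfolding L[symmetric] by blast
    then obtain s where s: "\<forall>v\<in>fv \<phi> - {x}. s v \<in> L_cf k \<beta> \<inter> N \<and> t v = collapse N (s v)"
      by metis
    obtain m where "elts m = L_cf k \<beta>"
      using L_level_is_set by blast
    then obtain y where y: "elts y = {a \<in> L_cf k \<beta>. sat_mem k (L_cf k \<beta>) (s(x := a)) \<phi>}"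
      using separation[of _ m] by (metis (no_types, lifting) mem_Collect_eq subsetI)
    have sN: "s ` (fv \<phi> - {x}) \<subseteq> L_cf k \<beta> \<inter> N" "s ` (fv \<phi> - {x}) \<subseteq> N"
      using s by auto
    have "y \<in> N"
      using comprehension[OF \<beta> sN(2) y] .
    moreover have "y \<in> definable_subsets fv (sat_cf k) (L_cf k \<beta>)"
      using s y unfolding definable_subsets_def by blast
    moreover have "sat_mem k (L_cf k (collapse N \<beta>)) ((collapse N \<circ> s)(x := a)) \<phi> \<longleftrightarrow>
        sat_mem k (L_cf k (collapse N \<beta>)) (t(x := a)) \<phi>" for a
      using s by (intro sat_cf_cong) auto
    then have "elts (collapse N y) = elts z"
      unfolding *[OF sN(1) y] t(2) by simp
    then have "z = collapse N y"
      using extensionality by metis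
    ultimately show "z \<in> collapse N ` (definable_subsets fv (sat_cf k) (L_cf k \<beta>) \<inter> N)"
      by blast
  qed
qed

text \<open>The recursion for levels depends on the kind of the index, so the closure of
  \<open>N\<close> has to ensure that the collapse sends zero, successor and limit indices to
  indices of the same kind.\<close>

lemma collapse_L_level:
  "ordinal \<alpha> \<Longrightarrow> \<alpha> \<in> N \<Longrightarrow> collapse N ` (L_cf k \<alpha> \<inter> N) = L_cf k (collapse N \<alpha>)"
proof (induction \<alpha> rule: mem_induct)
  case (mem \<alpha>)
  have IH: "collapse N ` (L_cf k \<beta> \<inter> N) = L_cf k (collapse N \<beta>)" if "\<beta> \<in> elts \<alpha> \<inter> N" for \<beta>
    using mem.IH that ordinal_mem[OF mem.prems(1)] by blast
  show ?case
  proof (cases rule: L_level_cases[where \<alpha> = \<alpha> and free = fv and sat = "sat_cf k"])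
    case zero
    then show ?thesis
      by (simp add: L_level_zero elts_collapse)
  next
    case (succ \<beta>)
    have \<beta>: "\<beta> \<in> N" "\<beta> \<in> elts \<alpha>"
      using predecessor[OF mem.prems(2) succ(1)] succ(1) by (auto simp: is_succ_def)
    then have "is_succ (collapse N \<beta>) (collapse N \<alpha>)"
      using succ(1) by (auto simp: is_succ_def elts_collapse)
    then have "L_cf k (collapse N \<alpha>) =
        definable_subsets fv (sat_cf k) (L_cf k (collapse N \<beta>))"
      by (rule L_level_succ)
    then show ?thesis
      using collapse_definable_subsets[OF \<beta>(1)] IH[of \<beta>] \<beta> succ(2) by simp
  next
    case limit
    have "elts (collapse N \<alpha>) \<noteq> {}"
      using member[OF mem.prems(2) limit(1)] by (simp add: elts_collapse)
    moreover have "\<not> is_succ \<gamma>' (collapse N \<alpha>)" for \<gamma>'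
    proof
      assume succ: "is_succ \<gamma>' (collapse N \<alpha>)"
      then have "\<gamma>' \<in> elts (collapse N \<alpha>)"
        by (simp add: is_succ_def)
      then obtain \<beta> where \<beta>: "\<beta> \<in> elts \<alpha>" "\<beta> \<in> N" "\<gamma>' = collapse N \<beta>"
        by (auto simp: elts_collapse)
      \<comment> \<open>Since \<alpha> is not a successor, some member of it lies above \<beta>. By
        \<open>between\<close> there is one in \<open>N\<close>, and its collapse lies above the
        alleged greatest element.\<close>
      have "insert \<beta> (elts \<beta>) \<subseteq> elts \<alpha>"
        using \<beta>(1) mem.prems(1) ordinal_trans by blast
      moreover have "elts \<alpha> \<noteq> insert \<beta> (elts \<beta>)"
        using limit(2) by (auto simp: is_succ_def)
      ultimately obtain \<gamma> where "\<gamma> \<in> elts \<alpha>" "\<gamma> \<noteq> \<beta>" "\<gamma> \<notin> elts \<beta>"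
        by blast
      then have "\<beta> \<in> elts \<gamma>"
        using ordinal_linear[of \<beta> \<gamma>] ordinal_mem[OF mem.prems(1)] \<beta>(1) by blast
      then obtain \<gamma> where \<gamma>: "\<gamma> \<in> elts \<alpha>" "\<gamma> \<in> N" "\<beta> \<in> elts \<gamma>"
        using between[OF mem.prems(2) \<beta>(2) \<open>\<gamma> \<in> elts \<alpha>\<close>] by blast
      then have "collapse N \<gamma> \<in> elts (collapse N \<alpha>)" and up: "\<gamma>' \<in> elts (collapse N \<gamma>)"
        using \<beta> by (auto simp: elts_collapse)
      then have "collapse N \<gamma> = \<gamma>' \<or> collapse N \<gamma> \<in> elts \<gamma>'"
        using succ by (simp add: is_succ_def)
      then show False
        using up mem_asym by metis
    qed
    ultimately have "L_cf k (collapse N \<alpha>) = (\<Union>\<beta>\<in>elts (collapse N \<alpha>). L_cf k \<beta>)"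
      by (intro L_level_limit) auto
    also have "\<dots> = (\<Union>\<beta>\<in>elts \<alpha> \<inter> N. collapse N ` (L_cf k \<beta> \<inter> N))"
      unfolding elts_collapse using IH by auto
    \<comment> \<open>By \<open>level\<close>, an element of \<open>N\<close> in the limit level
      already belongs to a level whose index is in \<open>N\<close>.\<close>
    also have "\<dots> = collapse N ` (L_cf k \<alpha> \<inter> N)"
      unfolding limit(3) using level[OF mem.prems(2)] by blast
    finally show ?thesis
      by simp
  qed
qed

end

section \<open>Counting subsets of an ordinal\<close>

theorem theorem5p24:
  fixes \<kappa> \<delta> :: "'v::zfc_universe"
  assumes "regular_cardinal \<kappa>"
    and "ordinal \<delta>"
  shows "|{x. elts x \<subseteq> elts \<delta>} \<inter> C_star \<kappa>| \<le>o cardSuc ( |elts \<delta>| *c cardSuc |elts \<kappa>| )"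
proof -
  define k where "k = |elts \<kappa>|"
  define l where "l = |elts \<delta>| *c cardSuc k"
  define X where "X = {x. elts x \<subseteq> elts \<delta>} \<inter> C_star \<kappa>"
  have k: "Cinfinite k"
    using assms(1) unfolding regular_cardinal_def k_def cinfinite_def
    by (simp add: Field_card_of card_of_card_order_on)
  have l: "Card_order l"
    unfolding l_def by (rule Card_order_cprod)
  have "|X| \<le>o cardSuc l"
  proof (cases "elts \<delta> = {}")
    case True
    have "X \<subseteq> {\<delta>}"
    proof
      fix x assume "x \<in> X"
      then have "elts x = elts \<delta>"
        unfolding X_def True by simp
      then show "x \<in> {\<delta>}"
        using extensionality by simp
    qed
    then have X: "|X| \<le>o |{\<delta>}|"
      by (rule card_of_mono1)
    have "Field (cardSuc l) \<noteq> {}"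
    proof
      assume "Field (cardSuc l) = {}"
      then have "cardSuc l =o (czero :: 'v rel)"
        using l by (intro czeroI cardSuc_Card_order)
      moreover have "(czero :: 'v rel) \<le>o l"
        unfolding czero_def using l by (intro card_of_empty1 disjI2)
      ultimately have "cardSuc l \<le>o l"
        by (rule ordIso_ordLeq_trans)
      then show False
        using cardSuc_greater[OF l] not_ordLess_ordLeq by metis
    qed
    then have "|{\<delta>}| \<le>o |Field (cardSuc l)|"
      by (rule card_of_singl_ordLeq)
    with X have "|X| \<le>o |Field (cardSuc l)|"
      by (rule ordLeq_transitive)
    also have "|Field (cardSuc l)| =o cardSuc l"
      using l by (intro card_of_Field_ordIso cardSuc_Card_order)
    finally show ?thesis .
  next
    case False
    have nz: "Cnotzero |elts \<delta>|"
      using False by (simp add: card_of_ordIso_czero_iff_empty card_of_Card_order)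
    have K: "Cinfinite (cardSuc k)"
      using k by (rule Cinfinite_cardSuc)
    have kl: "cardSuc k \<le>o l"
      unfolding l_def using nz K by (intro ordLeq_cprod2) auto
    have \<delta>l: "|elts \<delta>| \<le>o l"
      unfolding l_def cprod_def
      by (intro Card_order_Times1 card_of_Card_order Cnotzero_imp_not_empty Cinfinite_Cnotzero K)
    have lI: "Cinfinite l"
      using K kl l cinfinite_mono by blast
    let ?O = "{\<beta> :: 'v. ordinal \<beta> \<and> |elts \<beta>| \<le>o l}"
    have "X \<subseteq> (\<Union>\<beta>\<in>?O. L_cf k \<beta>)"
    proof
      fix a assume "a \<in> X"
      then obtain \<alpha> where a: "elts a \<subseteq> elts \<delta>" and \<alpha>: "ordinal \<alpha>" "a \<in> L_cf k \<alpha>"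
        unfolding X_def C_star_def C_logic_def k_def by auto
      \<comment> \<open>Including \<delta> makes the collapse fix \<open>a\<close>, and including
        \<alpha> makes it send the level of \<open>a\<close> to a level.\<close>
      have "|elts \<delta> \<union> {a, \<alpha>}| \<le>o l"
        by (intro Cinfinite_Un lI \<delta>l countable_ordLeq_Cinfinite) simp
      from cf_hull_exists[OF k l kl this] obtain N where
        N: "elts \<delta> \<union> {a, \<alpha>} \<subseteq> N" "|N| \<le>o l" "cf_hull k N"
        by auto
      interpret cf_hull k N
        by fact
      have "collapse N a = a"
        using collapse_fixes_transitive[of \<delta> N] N(1) a assms(2) unfolding ordinal_def by simp
      moreover have "collapse N a \<in> L_cf k (collapse N \<alpha>)"
        using collapse_L_level[OF \<alpha>(1)] \<alpha>(2) N(1) by auto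
      \<comment> \<open>Members of the collapsed index are images of elements of \<open>N\<close>,
        whatever the size of \<alpha>.\<close>
      moreover have "|elts (collapse N \<alpha>)| \<le>o l"
      proof -
        have "|elts (collapse N \<alpha>)| \<le>o |elts \<alpha> \<inter> N|"
          unfolding elts_collapse by (rule card_of_image)
        also have "|elts \<alpha> \<inter> N| \<le>o |N|"
          by (rule card_of_mono1) simp
        also note N(2)
        finally show ?thesis .
      qed
      ultimately show "a \<in> (\<Union>\<beta>\<in>?O. L_cf k \<beta>)"
        using ordinal_collapse[OF \<alpha>(1), of N] by auto
    qed
    moreover have "|\<Union>\<beta>\<in>?O. L_cf k \<beta>| \<le>o cardSuc l"
    proof (rule Cinfinite_UNION)
      show "Cinfinite (cardSuc l)"
        using lI by (rule Cinfinite_cardSuc)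
      show "|?O| \<le>o cardSuc l"
        using l by (rule card_ordinals_ordLeq)
      fix \<beta> assume "\<beta> \<in> ?O"
      then have "|L_cf k \<beta>| \<le>o l"
        using card_L_level[OF lI, of \<beta> k] by simp
      then show "|L_cf k \<beta>| \<le>o cardSuc l"
        using cardSuc_ordLeq[OF l] ordLeq_transitive by blast
    qed
    ultimately show ?thesis
      by (rule ordLeq_subset)
  qed
  then show ?thesis
    unfolding X_def l_def k_def .
qed

end
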